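(* Let $n\in\mathbb{N}\cup\{0\}$. There exists a unique smooth solution $Q_n$ to $$F'' + \frac{2r}{r^2+1}F' - \frac{\sin 2F}{r^2+1} = 0,\quad r\in\mathbb{R},\qquad F(-\infty)=0,\quad F(\infty)=n\pi .$$ In the case $n=0$, $Q_0 = 0$. For $n\in\mathbb{N}$ (i.e. $n \ge 1$), $Q_n$ is increasing on $\mathbb{R}$, satisfies $Q_n(r)+Q_n(-r)=n\pi$ for all $r\in\mathbb{R}$, and there exists $\alpha_n>0$ such that $$Q_n(r) = n\pi - \alpha_n r^{-2} + O(r^{-4})\quad\text{as } r\to\infty,$$ $$Q_n(r) = \alpha_n r^{-2} + O(r^{-4})\quad\text{as } r\to-\infty,$$ where the $O(\cdot)$ terms also satisfy the natural derivative bounds.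
   Context: $F(\pm\infty)$ denotes $\lim_{r\to\pm\infty}F(r)$. Natural derivative bounds for an error term $E(r)=O(r^{-4})$ means that for each integer $k\ge 0$, $|E^{(k)}(r)|\le C_k |r|^{-4-k}$ for $|r|$ large. *)

theory Defs
  imports "HOL-Analysis.Analysis" "HOL-Library.Landau_Symbols"
begin

definition smooth :: "(real \<Rightarrow> real) \<Rightarrow> bool" where
  "smooth f \<longleftrightarrow> (\<forall>k x. (deriv ^^ k) f differentiable (at x))"

definition solves_ode :: "(real \<Rightarrow> real) \<Rightarrow> bool" where
  "solves_ode F \<longleftrightarrow>
    (\<forall>r. deriv (deriv F) r + 2 * r / (r\<^sup>2 + 1) * deriv F r - sin (2 * F r) / (r\<^sup>2 + 1) = 0)"

definition smooth_solution :: "nat \<Rightarrow> (real \<Rightarrow> real) \<Rightarrow> bool" where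
  "smooth_solution n F \<longleftrightarrow>
    smooth F \<and> solves_ode F \<and> (F \<longlongrightarrow> 0) at_bot \<and> (F \<longlongrightarrow> real n * pi) at_top"

text \<open>
  \<open>E = O(r\<^sup>-\<^sup>m)\<close> with the natural derivative bounds
  \<open>\<bar>E\<^sup>(\<^sup>k\<^sup>)(r)\<bar> \<le> C\<^sub>k \<bar>r\<bar>\<^sup>-\<^sup>m\<^sup>-\<^sup>k\<close> for every \<open>k \<ge> 0\<close> along the filter \<open>G\<close>
  (\<open>at_top\<close> or \<open>at_bot\<close>); the case \<open>k = 0\<close> is the plain bound. The constant and the
  threshold for \<open>r\<close> may both depend on \<open>k\<close>. Differentiability of \<open>E\<close> is not part of
  the predicate: it is applied to smooth functions minus expansions smooth away from \<open>0\<close>.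
\<close>
definition bigo_deriv :: "nat \<Rightarrow> real filter \<Rightarrow> (real \<Rightarrow> real) \<Rightarrow> bool" where
  "bigo_deriv m G E \<longleftrightarrow>
    (\<forall>k. (deriv ^^ k) E \<in> O[G](\<lambda>r. \<bar>r\<bar> powi (- int m - int k)))"

end

(* In the self-adjoint form ((r^2+1) F')' = sin 2F the energy W = (r^2+1) F'^2 / 2 - sin^2 F satisfies
   W' = -r F'^2, so r is a time variable of a damped pendulum, symmetric under r -> -r.

   Monotonicity: W decreases on r >= 0 and W >= -sin^2 F, which tends to 0; hence W >= 0, and W > 0
   unless F is constant. So F' never vanishes.

   Existence: shoot from F(0) = n pi / 2 with F'(0) = b and take the infimum of all b >= 0 for which F
   exceeds n pi. At the infimum F stays below n pi, and it cannot stop at a lower multiple of pi: climbing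
   the last well costs a fixed amount of energy, so nearby trajectories would not cross n pi either.

   Uniqueness: written for r as a function of the level y = F, the action has a convex Lagrangian.
   Monotonicity of the Euler-Lagrange operator forces two solutions to agree once the boundary terms vanish,
   and this is guaranteed by the decay F - n pi ~ -alpha / r^2. The symmetry follows from uniqueness.

   Expansion: the Wronskian of n pi - F with the solution r of the equation linearised at infinity
   converges, which gives the leading term and the error of F and F'; higher derivatives are controlled by
   differentiating the equation. *)

theory Submission
  imports Defs
begin

section \<open>Initial value problem\<close>

text \<open>The potential is - sin^2 F, so the multiples of pi are unstable rest points and the
  trajectory has to cross the wells between them against damping. The danger is a trajectory that
  slows down forever. It is met by a bound independent of the speed: for r \<ge> 1 and nonnegative
  energy, the energy lost per unit of F is r |F'| \<ge> |sin F|. The exponents come from ((r^2+1)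
  v')' = 2 v, the linearisation at a multiple of pi. It has the exact solution r, and its other
  solutions behave at infinity like combinations of r and r^-2. The Wronskian of r and r^-2,
  weighted with r^2, is -3, which is why its limit is three times the coefficient sought. For
  uniqueness, comparing two solutions at equal r meets the coefficient 2 cos 2F, which changes sign
  along the solution, so there is no maximum principle. At equal level y the potential is the same
  for both and cancels; what remains is convex in the pair (r, r').\<close>

definition solution_pair :: "(real \<Rightarrow> real) \<Rightarrow> (real \<Rightarrow> real) \<Rightarrow> bool" where
  "solution_pair F p \<longleftrightarrow>
    (\<forall>r. (F has_real_derivative p r) (at r)) \<and>
    (\<forall>r. (p has_real_derivative (sin (2 * F r) - 2 * r * p r) / (r\<^sup>2 + 1)) (at r))"

lemma sq_plus_one_pos [simp]: "r\<^sup>2 + 1 > (0::real)" "r\<^sup>2 + 1 \<noteq> (0::real)"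
  by (auto simp: add_nonneg_pos add_nonneg_eq_0_iff)

lemma solution_pairD:
  assumes "solution_pair F p"
  shows "(F has_real_derivative p r) (at r)"
    and "(p has_real_derivative (sin (2 * F r) - 2 * r * p r) / (r\<^sup>2 + 1)) (at r)"
  using assms by (auto simp: solution_pair_def)

lemma solution_pair_continuous:
  assumes "solution_pair F p"
  shows "continuous_on S F" "continuous_on S p"
  using assms by (meson DERIV_continuous continuous_at_imp_continuous_on solution_pairD)+

text \<open>The equation is even in \<open>r\<close>, and replacing \<open>F\<close> by
  \<open>n * pi - F\<close> negates each of its terms. The composition exchanges the two boundary
  conditions, so facts about \<open>r \<ge> 0\<close> carry over to
  \<open>r \<le> 0\<close>.\<close>

lemma solution_pair_reflect:
  assumes "solution_pair F p"
  shows "solution_pair (\<lambda>r. real n * pi - F (- r)) (\<lambda>r. p (- r))"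
  unfolding solution_pair_def
proof (intro conjI allI)
  fix r
  have s: "sin (2 * (real n * pi - F (- r))) = - sin (2 * F (- r))"
    using sin_diff[of "real (2 * n) * pi" "2 * F (- r)"] unfolding sin_npi cos_npi
    by (simp add: algebra_simps)
  show "((\<lambda>r. real n * pi - F (- r)) has_real_derivative p (- r)) (at r)"
    using DERIV_mirror[of F "p (- r)" r] solution_pairD(1)[OF assms, of "- r"]
    by (auto intro!: derivative_eq_intros)
  show "((\<lambda>r. p (- r)) has_real_derivative
      (sin (2 * (real n * pi - F (- r))) - 2 * r * p (- r)) / (r\<^sup>2 + 1)) (at r)"
    unfolding s
    using DERIV_mirror[of p "(sin (2 * F (- r)) + 2 * r * p (- r)) / (r\<^sup>2 + 1)" r] solution_pairD(2)[OF assms, of "- r"]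
    by (simp add: minus_divide_left)
qed

section \<open>Continuous dependence on the initial data\<close>

lemma abs_sin_diff_le: "\<bar>sin x - sin y\<bar> \<le> \<bar>x - y\<bar>" for x y :: real
proof -
  have "sin x - sin y = 2 * sin ((x - y) / 2) * cos ((x + y) / 2)"
    by (rule sin_diff_sin)
  also have "\<bar>\<dots>\<bar> = 2 * \<bar>sin ((x - y) / 2)\<bar> * \<bar>cos ((x + y) / 2)\<bar>"
    by (simp add: abs_mult)
  also have "\<dots> \<le> 2 * \<bar>(x - y) / 2\<bar> * 1"
    by (intro mult_mono abs_sin_x_le_abs_x) auto
  finally show ?thesis by simp
qed

text \<open>Since \<open>\<bar>z' r\<bar>\<close> is bounded and not only \<open>z' r\<close>,
  \<open>z t * exp (- C * t)\<close> is nonincreasing and \<open>z t * exp (C * t)\<close> is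
  nondecreasing, which covers both directions of time.\<close>

lemma gronwall_two_sided:
  fixes z z' :: "real \<Rightarrow> real"
  assumes der: "\<And>r. (z has_real_derivative z' r) (at r)"
    and bound: "\<And>r. \<bar>z' r\<bar> \<le> C * z r"
  shows "z t \<le> z s * exp (C * \<bar>t - s\<bar>)"
proof (cases "s \<le> t")
  case True
  have "z t * exp (- C * t) \<le> z s * exp (- C * s)"
  proof (rule DERIV_nonpos_imp_nonincreasing[OF True])
    fix x
    have "((\<lambda>t. z t * exp (- C * t)) has_real_derivative (z' x - C * z x) * exp (- C * x)) (at x)"
      by (auto intro!: derivative_eq_intros der simp: algebra_simps)
    moreover have "(z' x - C * z x) * exp (- C * x) \<le> 0"
      using bound[of x] by (intro mult_nonpos_nonneg) auto
    ultimately show "\<exists>y. ((\<lambda>t. z t * exp (- C * t)) has_real_derivative y) (at x) \<and> y \<le> 0"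
      by blast
  qed
  from mult_right_mono[OF this, of "exp (C * t)"] show ?thesis
    using True by (simp add: mult.assoc flip: exp_add) (simp add: algebra_simps)
next
  case False
  then have le: "t \<le> s" by simp
  have "z t * exp (C * t) \<le> z s * exp (C * s)"
  proof (rule DERIV_nonneg_imp_nondecreasing[OF le])
    fix x
    have "((\<lambda>t. z t * exp (C * t)) has_real_derivative (z' x + C * z x) * exp (C * x)) (at x)"
      by (auto intro!: derivative_eq_intros der simp: algebra_simps)
    moreover have "(z' x + C * z x) * exp (C * x) \<ge> 0"
      using bound[of x] by (intro mult_nonneg_nonneg) auto
    ultimately show "\<exists>y. ((\<lambda>t. z t * exp (C * t)) has_real_derivative y) (at x) \<and> y \<ge> 0"
      by blast
  qed
  from mult_right_mono[OF this, of "exp (- C * t)"] show ?thesis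
    using le by (simp add: mult.assoc flip: exp_add) (simp add: algebra_simps)
qed

text \<open>The first-order system is Lipschitz in \<open>(F, p)\<close> uniformly in
  \<open>r\<close>, because 1/(r^2+1) and 2|r|/(r^2+1) are at most 1. With w and v the differences
  of the components, the derivative of w^2 + v^2 is at most 6 |w| |v| + 2 v^2 \<le> 5 (w^2 + v^2) in
  absolute value.\<close>

lemma solution_pair_stability:
  assumes F: "solution_pair F p" and G: "solution_pair G q"
  shows "(F t - G t)\<^sup>2 + (p t - q t)\<^sup>2 \<le> ((F s - G s)\<^sup>2 + (p s - q s)\<^sup>2) * exp (5 * \<bar>t - s\<bar>)"
proof (rule gronwall_two_sided)
  fix r
  define w v where "w = F r - G r" and "v = p r - q r"
  define v' where "v' = (sin (2 * F r) - 2 * r * p r) / (r\<^sup>2 + 1) - (sin (2 * G r) - 2 * r * q r) / (r\<^sup>2 + 1)"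
  show "((\<lambda>t. (F t - G t)\<^sup>2 + (p t - q t)\<^sup>2) has_real_derivative (2 * w * v + 2 * v * v')) (at r)"
    unfolding w_def v_def v'_def
    by (auto intro!: derivative_eq_intros solution_pairD[OF F] solution_pairD[OF G] simp: algebra_simps)
  have "v' = (sin (2 * F r) - sin (2 * G r)) / (r\<^sup>2 + 1) - (2 * r / (r\<^sup>2 + 1)) * v"
    unfolding v'_def v_def by (simp add: algebra_simps flip: add_divide_distrib diff_divide_distrib)
  moreover have "\<bar>(sin (2 * F r) - sin (2 * G r)) / (r\<^sup>2 + 1)\<bar> \<le> 2 * \<bar>w\<bar>"
  proof -
    have "\<bar>sin (2 * F r) - sin (2 * G r)\<bar> \<le> 2 * \<bar>w\<bar>"
      using abs_sin_diff_le[of "2 * F r" "2 * G r"]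
      unfolding w_def right_diff_distrib[symmetric] abs_mult by simp
    also have "\<dots> \<le> 2 * \<bar>w\<bar> * (r\<^sup>2 + 1)"
      by (simp add: mult_le_cancel_left1)
    finally show ?thesis by (simp add: divide_le_eq abs_mult)
  qed
  moreover have "\<bar>(2 * r / (r\<^sup>2 + 1)) * v\<bar> \<le> \<bar>v\<bar>"
  proof -
    have "\<bar>2 * r\<bar> \<le> r\<^sup>2 + 1"
      using zero_le_power2[of "\<bar>r\<bar> - 1"] by (simp add: power2_eq_square algebra_simps)
    then have "\<bar>2 * r / (r\<^sup>2 + 1)\<bar> \<le> 1"
      by (simp add: divide_le_eq)
    then show ?thesis
      using mult_right_mono[of "\<bar>2 * r / (r\<^sup>2 + 1)\<bar>" 1 "\<bar>v\<bar>"] by (simp only: abs_mult mult_1_left abs_ge_zero)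
  qed
  ultimately have "\<bar>v'\<bar> \<le> 2 * \<bar>w\<bar> + \<bar>v\<bar>" by linarith
  then have "\<bar>2 * w * v + 2 * v * v'\<bar> \<le> 2 * \<bar>w\<bar> * \<bar>v\<bar> + 2 * \<bar>v\<bar> * (2 * \<bar>w\<bar> + \<bar>v\<bar>)"
    by (intro order_trans[OF abs_triangle_ineq] add_mono)
      (auto simp: abs_mult intro!: mult_left_mono)
  also have "\<dots> \<le> 5 * (w\<^sup>2 + v\<^sup>2)"
  proof -
    have "2 * \<bar>w\<bar> * \<bar>v\<bar> + 2 * \<bar>v\<bar> * (2 * \<bar>w\<bar> + \<bar>v\<bar>) = 5 * (\<bar>w\<bar>\<^sup>2 + \<bar>v\<bar>\<^sup>2) - 3 * (\<bar>w\<bar> - \<bar>v\<bar>)\<^sup>2 - 2 * \<bar>w\<bar>\<^sup>2"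
      by (simp only: power2_eq_square) algebra
    then have "2 * \<bar>w\<bar> * \<bar>v\<bar> + 2 * \<bar>v\<bar> * (2 * \<bar>w\<bar> + \<bar>v\<bar>) \<le> 5 * (\<bar>w\<bar>\<^sup>2 + \<bar>v\<bar>\<^sup>2)"
      using zero_le_power2[of "\<bar>w\<bar> - \<bar>v\<bar>"] zero_le_power2[of "\<bar>w\<bar>"] by linarith
    then show ?thesis by simp
  qed
  finally show "\<bar>2 * w * v + 2 * v * v'\<bar> \<le> 5 * ((F r - G r)\<^sup>2 + (p r - q r)\<^sup>2)"
    unfolding w_def v_def .
qed

lemma solution_pair_unique:
  assumes "solution_pair F p" "solution_pair G q" "F s = G s" "p s = q s"
  shows "F t = G t" "p t = q t"
  using solution_pair_stability[OF assms(1,2), of t s] assms(3,4)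
  by (auto simp: sum_power2_le_zero_iff)

lemma solution_pair_const:
  assumes "sin (2 * c) = 0"
  shows "solution_pair (\<lambda>_. c) (\<lambda>_. 0)"
  using assms by (auto simp: solution_pair_def)

section \<open>Global existence by contraction\<close>

lemma continuous_has_antiderivative:
  fixes g :: "real \<Rightarrow> real"
  assumes "continuous_on UNIV g"
  obtains G where "G 0 = 0" "\<And>x. (G has_real_derivative g x) (at x)"
proof -
  have "\<exists>F. \<forall>x :: real. -\<infinity> < ereal x \<longrightarrow> ereal x < \<infinity> \<longrightarrow> (F has_vector_derivative g x) (at x)"
    using assms by (intro einterval_antiderivative) (auto simp: continuous_on_eq_continuous_at)
  then obtain F where "\<And>x. (F has_real_derivative g x) (at x)"
    by (auto simp: has_real_derivative_iff_has_vector_derivative)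
  then show ?thesis
    by (intro that[of "\<lambda>x. F x - F 0"]) (auto intro!: derivative_eq_intros)
qed

text \<open>Comparison of \<open>D\<close> and \<open>- D\<close> with
  \<open>M / 2 * exp (2 * x)\<close>, the primitive of the bound; negative times follow by
  reflection.\<close>

lemma exp_weighted_integral_bound:
  fixes D d :: "real \<Rightarrow> real"
  assumes D0: "D 0 = 0" and der: "\<And>x. (D has_real_derivative d x) (at x)"
    and bound: "\<And>x. \<bar>d x\<bar> \<le> M * exp (2 * \<bar>x\<bar>)"
  shows "\<bar>D t\<bar> \<le> M / 2 * exp (2 * \<bar>t\<bar>)"
proof -
  have M: "M \<ge> 0"
    using bound[of 0] by simp
  have *: "\<bar>D t\<bar> \<le> M / 2 * exp (2 * t)" if "D 0 = 0" and der: "\<And>x. (D has_real_derivative d x) (at x)"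
    and bound: "\<And>x. \<bar>d x\<bar> \<le> M * exp (2 * \<bar>x\<bar>)" and t: "0 \<le> t" for D d and t :: real
  proof -
    have "M / 2 * exp (2 * 0) - s * D 0 \<le> M / 2 * exp (2 * t) - s * D t" if s: "\<bar>s\<bar> = 1" for s
    proof (rule DERIV_nonneg_imp_nondecreasing[OF t])
      fix x :: real assume x: "0 \<le> x" "x \<le> t"
      have "((\<lambda>x. M / 2 * exp (2 * x) - s * D x) has_real_derivative M * exp (2 * x) - s * d x) (at x)"
        by (auto intro!: derivative_eq_intros der)
      moreover have "s * d x \<le> M * exp (2 * x)"
        using bound[of x] s x abs_ge_self[of "s * d x"] by (simp add: abs_mult)
      ultimately show "\<exists>y. ((\<lambda>x. M / 2 * exp (2 * x) - s * D x) has_real_derivative y) (at x) \<and> 0 \<le> y"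
        by (intro exI[of _ "M * exp (2 * x) - s * d x"]) auto
    qed
    from this[of 1] this[of "-1"] show ?thesis
      using \<open>D 0 = 0\<close> M by (simp add: abs_le_iff)
  qed
  show ?thesis
  proof (cases "t \<ge> 0")
    case True
    then show ?thesis using *[OF D0 der bound] by simp
  next
    case False
    have "\<bar>(\<lambda>x. D (- x)) (- t)\<bar> \<le> M / 2 * exp (2 * (- t))"
    proof (rule *)
      fix x
      show "((\<lambda>x. D (- x)) has_real_derivative - d (- x)) (at x)"
        using DERIV_mirror[of D "d (- x)" x] der[of "- x"] by simp
      show "\<bar>- d (- x)\<bar> \<le> M * exp (2 * \<bar>x\<bar>)"
        using bound[of "- x"] by simp
    qed (use D0 False in auto)
    then show ?thesis using False by simp
  qed
qed

text \<open>Picard iteration in the norm \<open>sup \<bar>F t\<bar> exp (- 2 \<bar>t\<bar>)\<close>, for which each of the two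
  integrations gains a factor 1/2.\<close>
lemma solution_pair_exists:
  obtains F p where "solution_pair F p" "F 0 = a" "p 0 = b"
proof -
  \<comment> \<open>The primitive vanishing at 0. It is specified only for continuous
    \<open>g\<close>, hence the continuity facts about every function that gets integrated.\<close>
  define I where "I g = (SOME G. G 0 = 0 \<and> (\<forall>x. (G has_real_derivative g x) (at x)))"
    for g :: "real \<Rightarrow> real"
  have I: "I g 0 = 0" "(I g has_real_derivative g x) (at x)" if "continuous_on UNIV g" for g x
  proof -
    have "\<exists>G. G 0 = 0 \<and> (\<forall>x. (G has_real_derivative g x) (at x))"
      using continuous_has_antiderivative[OF that] by metis
    from someI_ex[OF this] show "I g 0 = 0" "(I g has_real_derivative g x) (at x)"
      unfolding I_def by blast+
  qed
  have I_cont: "continuous_on UNIV (I g)" if "continuous_on UNIV g" for g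
    using I(2)[OF that] by (meson DERIV_continuous continuous_at_imp_continuous_on)
  \<comment> \<open>A bounded continuous \<open>h\<close> stands for the possibly unbounded function
    \<open>u h\<close>, so that the plain sup distance of \<open>h\<close> is the weighted one.
    \<open>P\<close> and \<open>T\<close> integrate the self-adjoint form twice, with the initial
    data built in.\<close>
  define u where "u h t = exp (2 * \<bar>t\<bar>) * apply_bcontfun h t" for h :: "real \<Rightarrow>\<^sub>C real" and t
  define P where "P h t = (b + I (\<lambda>x. sin (2 * u h x)) t) / (t\<^sup>2 + 1)" for h t
  define T where "T h t = a + I (P h) t" for h t
  have u_cont: "continuous_on UNIV (u h)" for h
    unfolding u_def by (intro continuous_intros continuous_on_apply_bcontfun)
  have s_cont: "continuous_on UNIV (\<lambda>x. sin (2 * u h x))" for h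
    by (intro continuous_intros u_cont)
  have P_cont: "continuous_on UNIV (P h)" for h
    unfolding P_def by (intro continuous_intros I_cont s_cont) auto
  have div_le: "\<bar>x / (t\<^sup>2 + 1)\<bar> \<le> \<bar>x\<bar>" for x t :: real
  proof -
    have "\<bar>x\<bar> * 1 \<le> \<bar>x\<bar> * (t\<^sup>2 + 1)"
      by (intro mult_left_mono) auto
    then show ?thesis by (simp add: divide_le_eq)
  qed
  have exp_ge: "1 \<le> exp (2 * \<bar>t\<bar>)" for t :: real by simp
  have P_bound: "\<bar>P h t\<bar> \<le> (\<bar>b\<bar> + 1 / 2) * exp (2 * \<bar>t\<bar>)" for h t
  proof -
    have "\<bar>I (\<lambda>x. sin (2 * u h x)) t\<bar> \<le> 1 / 2 * exp (2 * \<bar>t\<bar>)"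
    proof (rule exp_weighted_integral_bound)
      show "\<bar>sin (2 * u h x)\<bar> \<le> 1 * exp (2 * \<bar>x\<bar>)" for x
        using exp_ge[of x] abs_sin_le_one[of "2 * u h x"] by linarith
    qed (use I[OF s_cont] in auto)
    moreover have "\<bar>b\<bar> * 1 \<le> \<bar>b\<bar> * exp (2 * \<bar>t\<bar>)"
      by (intro mult_left_mono exp_ge) auto
    ultimately have "\<bar>b + I (\<lambda>x. sin (2 * u h x)) t\<bar> \<le> (\<bar>b\<bar> + 1 / 2) * exp (2 * \<bar>t\<bar>)"
      by (simp add: algebra_simps)
    then show ?thesis
      unfolding P_def using div_le order_trans by blast
  qed
  have T_bound: "\<bar>exp (- 2 * \<bar>t\<bar>) * T h t\<bar> \<le> \<bar>a\<bar> + (\<bar>b\<bar> + 1 / 2) / 2" for h t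
  proof -
    have "\<bar>I (P h) t\<bar> \<le> (\<bar>b\<bar> + 1 / 2) / 2 * exp (2 * \<bar>t\<bar>)"
      by (rule exp_weighted_integral_bound) (use I[OF P_cont] P_bound in auto)
    moreover have "\<bar>a\<bar> * 1 \<le> \<bar>a\<bar> * exp (2 * \<bar>t\<bar>)"
      by (intro mult_left_mono exp_ge) auto
    ultimately have "\<bar>T h t\<bar> \<le> (\<bar>a\<bar> + (\<bar>b\<bar> + 1 / 2) / 2) * exp (2 * \<bar>t\<bar>)"
      unfolding T_def using abs_triangle_ineq[of a "I (P h) t"] unfolding distrib_right by linarith
    then have "exp (- 2 * \<bar>t\<bar>) * \<bar>T h t\<bar> \<le> exp (- 2 * \<bar>t\<bar>) * ((\<bar>a\<bar> + (\<bar>b\<bar> + 1 / 2) / 2) * exp (2 * \<bar>t\<bar>))"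
      by (intro mult_left_mono) auto
    also have "\<dots> = \<bar>a\<bar> + (\<bar>b\<bar> + 1 / 2) / 2"
      by (simp add: exp_minus field_simps)
    finally show ?thesis by (simp add: abs_mult)
  qed
  define \<Phi> where "\<Phi> h = Bcontfun (\<lambda>t. exp (- 2 * \<bar>t\<bar>) * T h t)" for h
  have T_cont: "continuous_on UNIV (T h)" for h
    unfolding T_def by (intro continuous_intros I_cont P_cont)
  have \<Phi>: "apply_bcontfun (\<Phi> h) = (\<lambda>t. exp (- 2 * \<bar>t\<bar>) * T h t)" for h
    unfolding \<Phi>_def
  proof (rule Bcontfun_inverse, rule bcontfun_normI)
    show "continuous_on UNIV (\<lambda>t. exp (- 2 * \<bar>t\<bar>) * T h t)"
      by (intro continuous_intros T_cont)
    show "norm (exp (- 2 * \<bar>t\<bar>) * T h t) \<le> \<bar>a\<bar> + (\<bar>b\<bar> + 1 / 2) / 2" for t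
      using T_bound[of t h] by simp
  qed
  \<comment> \<open>The factor is 2 * 1/2 * 1/2: the Lipschitz constant 2 of
    \<open>sin (2 * x)\<close> and a gain of 1/2 from each integration.\<close>
  have "dist (\<Phi> h) (\<Phi> k) \<le> 1 / 2 * dist h k" for h k
  proof (rule dist_bound)
    fix t
    let ?d = "dist h k"
    have 1: "\<bar>sin (2 * u h x) - sin (2 * u k x)\<bar> \<le> (2 * ?d) * exp (2 * \<bar>x\<bar>)" for x
    proof -
      have "\<bar>sin (2 * u h x) - sin (2 * u k x)\<bar> \<le> 2 * \<bar>u h x - u k x\<bar>"
        using abs_sin_diff_le[of "2 * u h x" "2 * u k x"]
        unfolding right_diff_distrib[symmetric] abs_mult by simp
      also have "\<bar>u h x - u k x\<bar> = exp (2 * \<bar>x\<bar>) * dist (apply_bcontfun h x) (apply_bcontfun k x)"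
        unfolding u_def dist_real_def by (simp add: abs_mult flip: right_diff_distrib)
      also have "\<dots> \<le> exp (2 * \<bar>x\<bar>) * ?d"
        by (intro mult_left_mono dist_bounded) auto
      finally show ?thesis by (simp add: mult_ac)
    qed
    have 2: "\<bar>P h x - P k x\<bar> \<le> ?d * exp (2 * \<bar>x\<bar>)" for x
    proof -
      have "\<bar>I (\<lambda>x. sin (2 * u h x)) x - I (\<lambda>x. sin (2 * u k x)) x\<bar> \<le> (2 * ?d) / 2 * exp (2 * \<bar>x\<bar>)"
        by (rule exp_weighted_integral_bound[OF _ _ 1])
          (use I[OF s_cont] in \<open>auto intro!: derivative_eq_intros\<close>)
      moreover have "P h x - P k x = (I (\<lambda>x. sin (2 * u h x)) x - I (\<lambda>x. sin (2 * u k x)) x) / (x\<^sup>2 + 1)"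
        unfolding P_def by (simp flip: diff_divide_distrib)
      ultimately show ?thesis using div_le[of "I (\<lambda>x. sin (2 * u h x)) x - I (\<lambda>x. sin (2 * u k x)) x" x]
        by simp
    qed
    have "\<bar>I (P h) t - I (P k) t\<bar> \<le> ?d / 2 * exp (2 * \<bar>t\<bar>)"
      by (rule exp_weighted_integral_bound[OF _ _ 2])
        (use I[OF P_cont] in \<open>auto intro!: derivative_eq_intros\<close>)
    then have "exp (- 2 * \<bar>t\<bar>) * \<bar>T h t - T k t\<bar> \<le> exp (- 2 * \<bar>t\<bar>) * (?d / 2 * exp (2 * \<bar>t\<bar>))"
      unfolding T_def by (intro mult_left_mono) auto
    also have "\<dots> = 1 / 2 * ?d"
      by (simp add: exp_minus field_simps)
    finally show "dist (apply_bcontfun (\<Phi> h) t) (apply_bcontfun (\<Phi> k) t) \<le> 1 / 2 * ?d"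
      unfolding \<Phi> dist_real_def by (simp add: abs_mult flip: right_diff_distrib)
  qed
  then have "\<exists>!h. \<Phi> h = h"
    by (intro banach_fix_type[of "1/2"]) auto
  then obtain h where h: "\<Phi> h = h" by auto
  have uT: "u h = T h"
    using \<Phi>[of h] unfolding h by (auto simp: fun_eq_iff u_def exp_minus)
  have "solution_pair (T h) (P h)"
    unfolding solution_pair_def
  proof (intro conjI allI)
    fix r
    show "(T h has_real_derivative P h r) (at r)"
      unfolding T_def by (auto intro!: derivative_eq_intros I[OF P_cont])
    have quotient: "(S * D - A * R) / (D * D) = (S - R * (A / D)) / D" if "D \<noteq> 0" for S D A R :: real
      using that by (simp add: field_simps)
    have "(P h has_real_derivative (sin (2 * u h r) * (r\<^sup>2 + 1) - (b + I (\<lambda>x. sin (2 * u h x)) r) * (2 * r))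
        / ((r\<^sup>2 + 1) * (r\<^sup>2 + 1))) (at r)"
      unfolding P_def by (auto intro!: derivative_eq_intros I[OF s_cont])
    then show "(P h has_real_derivative (sin (2 * T h r) - 2 * r * P h r) / (r\<^sup>2 + 1)) (at r)"
      unfolding quotient[OF sq_plus_one_pos(2)] by (simp add: uT P_def)
  qed
  moreover have "T h 0 = a" "P h 0 = b"
    using I(1)[OF P_cont] I(1)[OF s_cont] by (auto simp: T_def P_def[of _ 0])
  ultimately show ?thesis using that by blast
qed

section \<open>Energy and shooting\<close>

definition energy :: "(real \<Rightarrow> real) \<Rightarrow> (real \<Rightarrow> real) \<Rightarrow> real \<Rightarrow> real" where
  "energy F p r = (r\<^sup>2 + 1) * (p r)\<^sup>2 / 2 - (sin (F r))\<^sup>2"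

lemma energy_deriv:
  assumes "solution_pair F p"
  shows "(energy F p has_real_derivative - r * (p r)\<^sup>2) (at r)"
proof -
  define D P where "D = r\<^sup>2 + 1" and "P = (sin (2 * F r) - 2 * r * p r) / D"
  have DP: "D * P = 2 * sin (F r) * cos (F r) - 2 * r * p r"
    unfolding D_def P_def by (simp add: sin_double)
  have [derivative_intros]: "(F has_real_derivative p r) (at r)" "(p has_real_derivative P) (at r)"
    unfolding P_def D_def by (rule solution_pairD[OF assms])+
  have "((\<lambda>r. (r\<^sup>2 + 1) * (p r)\<^sup>2 / 2 - (sin (F r))\<^sup>2) has_real_derivative
      r * (p r)\<^sup>2 + p r * (D * P) - 2 * sin (F r) * cos (F r) * p r) (at r)"
    unfolding D_def by (auto intro!: derivative_eq_intros simp: power2_eq_square algebra_simps)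
  also have "r * (p r)\<^sup>2 + p r * (D * P) - 2 * sin (F r) * cos (F r) * p r = - r * (p r)\<^sup>2"
    unfolding DP by (simp add: power2_eq_square algebra_simps)
  finally show ?thesis unfolding energy_def [abs_def] .
qed

lemma energy_antimono:
  assumes "solution_pair F p" "0 \<le> r" "r \<le> s"
  shows "energy F p s \<le> energy F p r"
proof (rule DERIV_nonpos_imp_nonincreasing[OF assms(3)])
  fix x assume "r \<le> x" "x \<le> s"
  then show "\<exists>y. (energy F p has_real_derivative y) (at x) \<and> y \<le> 0"
    using energy_deriv[OF assms(1), of x] assms(2) by (intro exI conjI) auto
qed

lemma energy_reflect:
  "energy (\<lambda>r. real n * pi - F (- r)) (\<lambda>r. p (- r)) r = energy F p (- r)"
  unfolding energy_def by (simp add: sin_diff power_mult_distrib flip: power_mult)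

lemma sin_sq_le_energy: "- (sin (F r))\<^sup>2 \<le> energy F p r"
  unfolding energy_def by simp

text \<open>Energy that is nonincreasing, nonnegative and zero at \<open>r\<close> stays zero
  afterwards. Its derivative \<open>- x * (p x)\<^sup>2\<close> then vanishes for
  \<open>x > r\<close>, where \<open>x > 0\<close>, so \<open>p\<close> is zero there and
  \<open>F\<close> rests at a zero of sin. Uniqueness for the initial value problem extends this to
  all times.\<close>

lemma energy_zero_imp_const:
  assumes sol: "solution_pair F p" and r: "0 \<le> r"
    and zero: "energy F p r = 0" and nonneg: "\<And>s. s > r \<Longrightarrow> energy F p s \<ge> 0"
  shows "F t = F r" "p t = 0" "sin (F r) = 0"
proof -
  define s where "s = r + 1"
  have s: "r < s" "0 < s" using r by (auto simp: s_def)
  have e0: "energy F p x = 0" if "x > r" for x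
    using nonneg[OF that] energy_antimono[OF sol r, of x] that zero by simp
  have p0: "p x = 0" if "x > r" for x
  proof -
    have "((\<lambda>_. 0) has_real_derivative - x * (p x)\<^sup>2) (at x)"
    proof (rule has_field_derivative_transform_within_open[OF energy_deriv[OF sol]])
      show "open {r<..}" by simp
    qed (use e0 that in auto)
    then have "- x * (p x)\<^sup>2 = 0"
      using DERIV_unique DERIV_const by blast
    then show ?thesis using that r by simp
  qed
  have "sin (F s) = 0"
    using e0[OF s(1)] p0[OF s(1)] by (simp add: energy_def)
  then have "solution_pair (\<lambda>_. F s) (\<lambda>_. 0)"
    by (intro solution_pair_const) (simp add: sin_double)
  then have *: "F x = F s \<and> p x = 0" for x
    using solution_pair_unique[OF sol, of "\<lambda>_. F s" "\<lambda>_. 0" s] p0[OF s(1)] by blast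
  then show "F t = F r" "p t = 0" "sin (F r) = 0"
    using \<open>sin (F s) = 0\<close> by metis+
qed

lemma energy_pos_imp_deriv_nz:
  assumes "energy F p r > 0"
  shows "p r \<noteq> 0"
  using assms by (auto simp: energy_def not_less)

text \<open>Makes the dissipation rate \<open>r * (p r)\<^sup>2\<close> at least
  \<open>\<bar>sin (F r)\<bar> * \<bar>p r\<bar>\<close>, which integrates to a difference of
  cosines depending only on the levels passed, not on the time taken. From time 1 on, (r^2+1)/2
  \<le> r^2.\<close>

lemma abs_sin_le_of_energy:
  assumes "energy F p r \<ge> 0" "r \<ge> 1"
  shows "\<bar>sin (F r)\<bar> \<le> r * \<bar>p r\<bar>"
proof (rule power2_le_imp_le)
  have "r\<^sup>2 + 1 \<le> 2 * r\<^sup>2"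
    using assms(2) by simp
  then have "(r\<^sup>2 + 1) * (p r)\<^sup>2 \<le> 2 * r\<^sup>2 * (p r)\<^sup>2"
    by (intro mult_right_mono) auto
  then show "\<bar>sin (F r)\<bar>\<^sup>2 \<le> (r * \<bar>p r\<bar>)\<^sup>2"
    using assms(1) by (simp add: energy_def power_mult_distrib)
qed (use assms in auto)

text \<open>While the energy is nonnegative, climbing from \<open>n\<pi> - \<pi>/3\<close> to \<open>n\<pi>\<close> after time 1 costs
  energy at least \<open>\<bar>cos (n\<pi>) - cos (n\<pi> - \<pi>/3)\<bar> = 1/2\<close>.\<close>
lemma no_crossing:
  assumes sol: "solution_pair F p" and r1: "1 \<le> r1" "r1 \<le> r2"
    and F1: "F r1 \<le> real n * pi - pi / 3" and e1: "energy F p r1 < 1 / 2"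
  shows "F r2 \<noteq> real n * pi"
proof
  assume F2: "F r2 = real n * pi"
  have "\<exists>r\<ge>r1. r \<le> r2 \<and> F r = real n * pi - pi / 3"
    by (rule IVT') (use F1 F2 r1 solution_pair_continuous[OF sol] in auto)
  then obtain s where s: "r1 \<le> s" "s \<le> r2" "F s = real n * pi - pi / 3" by blast
  have e2: "energy F p r2 \<ge> 0"
    using F2 by (simp add: energy_def)
  have e: "energy F p x \<ge> 0" if "s \<le> x" "x \<le> r2" for x
    using energy_antimono[OF sol, of x r2] that s r1 e2 by simp
  \<comment> \<open>The sum is nonincreasing whatever the sign of \<open>p x\<close>, so
    \<open>F\<close> need not climb monotonically. The energy is nonnegative on the way because it
    is so at \<open>r2\<close>, where sin vanishes.\<close>
  have "energy F p r2 + cos (real n * pi - F r2) \<le> energy F p s + cos (real n * pi - F s)"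
  proof (rule DERIV_nonpos_imp_nonincreasing[OF s(2)])
    fix x assume x: "s \<le> x" "x \<le> r2"
    then have x1: "x \<ge> 1" using s r1 by simp
    have "((\<lambda>x. energy F p x + cos (real n * pi - F x)) has_real_derivative
        - x * (p x)\<^sup>2 + sin (real n * pi - F x) * p x) (at x)"
      by (auto intro!: derivative_eq_intros energy_deriv[OF sol] solution_pairD[OF sol])
    moreover have "sin (real n * pi - F x) * p x \<le> x * (p x)\<^sup>2"
    proof -
      have "sin (real n * pi - F x) * p x \<le> \<bar>sin (real n * pi - F x)\<bar> * \<bar>p x\<bar>"
        by (metis abs_ge_self abs_mult)
      also have "\<bar>sin (real n * pi - F x)\<bar> = \<bar>sin (F x)\<bar>"
        by (simp add: sin_diff abs_mult power_abs)
      also have "\<bar>sin (F x)\<bar> * \<bar>p x\<bar> \<le> (x * \<bar>p x\<bar>) * \<bar>p x\<bar>"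
        by (intro mult_right_mono abs_sin_le_of_energy e x x1) auto
      also have "\<dots> = x * (p x)\<^sup>2" by (simp add: power2_eq_square)
      finally show ?thesis .
    qed
    ultimately show "\<exists>y. ((\<lambda>x. energy F p x + cos (real n * pi - F x)) has_real_derivative y) (at x) \<and> y \<le> 0"
      by (intro exI conjI) auto
  qed
  then have "energy F p s \<ge> 1 / 2"
    using F2 s(3) e2 by (simp add: cos_60)
  then show False
    using energy_antimono[OF sol, of r1 s] s r1 e1 by simp
qed

section \<open>The shooting argument\<close>

lemma deriv_ge_reciprocal_imp_unbounded:
  fixes F p :: "real \<Rightarrow> real"
  assumes der: "\<And>r. (F has_real_derivative p r) (at r)"
    and R: "R \<ge> 0" and c: "c > 0" and bound: "\<And>r. r \<ge> R \<Longrightarrow> p r * (r + 1) \<ge> c"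
  shows "\<exists>r\<ge>R. F r > B"
proof -
  \<comment> \<open>Chosen so that \<open>c * ln (r + 1)\<close> exceeds
    \<open>c * ln (R + 1)\<close> by exactly
    \<open>\<bar>B\<bar> + \<bar>F R\<bar> + 1\<close>.\<close>
  define r where "r = exp ((\<bar>B\<bar> + \<bar>F R\<bar> + 1) / c + ln (R + 1)) - 1"
  have "(\<bar>B\<bar> + \<bar>F R\<bar> + 1) / c \<ge> 0" using c by auto
  then have "ln (R + 1) \<le> (\<bar>B\<bar> + \<bar>F R\<bar> + 1) / c + ln (R + 1)" by simp
  then have "R + 1 \<le> exp ((\<bar>B\<bar> + \<bar>F R\<bar> + 1) / c + ln (R + 1))"
    using R by (subst (asm) exp_le_cancel_iff[symmetric]) simp
  then have r: "R \<le> r" unfolding r_def by simp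
  have "F R - c * ln (R + 1) \<le> F r - c * ln (r + 1)"
  proof (rule DERIV_nonneg_imp_nondecreasing[OF r])
    fix x assume x: "R \<le> x" "x \<le> r"
    have "((\<lambda>r. F r - c * ln (r + 1)) has_real_derivative p x - c / (x + 1)) (at x)"
      using x R by (auto intro!: derivative_eq_intros der)
    moreover have "p x - c / (x + 1) \<ge> 0"
      using bound[OF x(1)] x R by (simp add: divide_le_eq)
    ultimately show "\<exists>y. ((\<lambda>r. F r - c * ln (r + 1)) has_real_derivative y) (at x) \<and> 0 \<le> y" by blast
  qed
  moreover have "c * ln (r + 1) = \<bar>B\<bar> + \<bar>F R\<bar> + 1 + c * ln (R + 1)"
    unfolding r_def using c by (simp add: distrib_left[of c _ "ln (R + 1)"] del: distrib_left_numeral)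
  ultimately have "F r > B" by linarith
  then show ?thesis using r by blast
qed

text \<open>Only the limit at plus infinity is needed: \<open>n * pi / 2\<close> is the value fixed
  by \<open>F\<close> -> \<open>n * pi - F\<close>, so the other half line is supplied by
  reflection.\<close>

lemma shooting:
  assumes n: "n \<ge> 1"
  obtains F p where "solution_pair F p" "F 0 = real n * pi / 2" "(F \<longlongrightarrow> real n * pi) at_top"
proof -
  define a where "a = real n * pi"
  have a: "a \<ge> pi" using n by (simp add: a_def)
  have a_pos: "a > 0" using a pi_gt_zero by linarith
  have sin_a: "sin a = 0" by (simp add: a_def)
  have "\<forall>b. \<exists>Fp. solution_pair (fst Fp) (snd Fp) \<and> fst Fp 0 = a / 2 \<and> snd Fp 0 = b"
    by (metis solution_pair_exists fst_conv snd_conv)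
  then obtain Fp where Fp: "\<And>b. solution_pair (fst (Fp b)) (snd (Fp b))"
      "\<And>b. fst (Fp b) 0 = a / 2" "\<And>b. snd (Fp b) 0 = b"
    by metis
  define F p where "F b = fst (Fp b)" and "p b = snd (Fp b)" for b
  have sol: "solution_pair (F b) (p b)" and F0: "F b 0 = a / 2" and p0: "p b 0 = b" for b
    using Fp by (auto simp: F_def p_def)
  \<comment> \<open>The square root of the factor \<open>exp (5 * \<bar>t\<bar>)\<close> of the
    stability estimate: a Lipschitz constant in the slope \<open>b\<close> at time
    \<open>t\<close>.\<close>
  define K where "K t = exp (5 / 2 * \<bar>t\<bar>)" for t :: real
  have K: "K t > 0" for t by (simp add: K_def)
  have stab: "(F b t - F c t)\<^sup>2 + (p b t - p c t)\<^sup>2 \<le> (\<bar>b - c\<bar> * K t)\<^sup>2" for b c t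
  proof -
    have "(K t)\<^sup>2 = exp (5 * \<bar>t - 0\<bar>)"
      by (simp add: K_def power2_eq_square flip: exp_add)
    then show ?thesis
      using solution_pair_stability[OF sol[of b] sol[of c], of t 0] by (simp add: F0 p0 power_mult_distrib)
  qed
  have F_lip: "\<bar>F b t - F c t\<bar> \<le> \<bar>b - c\<bar> * K t" and p_lip: "\<bar>p b t - p c t\<bar> \<le> \<bar>b - c\<bar> * K t" for b c t
  proof -
    have "(F b t - F c t)\<^sup>2 \<le> (\<bar>b - c\<bar> * K t)\<^sup>2" "(p b t - p c t)\<^sup>2 \<le> (\<bar>b - c\<bar> * K t)\<^sup>2"
      using stab[of b t c] zero_le_power2[of "F b t - F c t"] zero_le_power2[of "p b t - p c t"]
      by linarith+
    then show "\<bar>F b t - F c t\<bar> \<le> \<bar>b - c\<bar> * K t" "\<bar>p b t - p c t\<bar> \<le> \<bar>b - c\<bar> * K t"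
      using K[of t] by (simp_all add: abs_le_square_iff[symmetric] abs_mult)
  qed
  have cont: "isCont (\<lambda>b. F b t) b" "isCont (\<lambda>b. p b t) b" for b t
  proof -
    have "(K t)-lipschitz_on UNIV (\<lambda>b. F b t)" "(K t)-lipschitz_on UNIV (\<lambda>b. p b t)"
      using F_lip p_lip K[of t] by (auto intro!: lipschitz_onI simp: dist_real_def mult.commute)
    then show "isCont (\<lambda>b. F b t) b" "isCont (\<lambda>b. p b t) b"
      by (auto dest!: lipschitz_on_continuous_on simp: continuous_on_eq_continuous_at)
  qed
  have cont_nhds: "((\<lambda>b. F b t) \<longlongrightarrow> F b t) (nhds b)" for b t
    using cont(1)[of b t] unfolding isCont_def by (subst (asm) tendsto_at_iff_tendsto_nhds)
  have cont_energy: "isCont (\<lambda>b. energy (F b) (p b) t) b" for b t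
    unfolding energy_def by (intro continuous_intros cont) auto
  have cont_energy_nhds: "((\<lambda>b. energy (F b) (p b) t) \<longlongrightarrow> energy (F b) (p b) t) (nhds b)" for b t
    using cont_energy[of b t] unfolding isCont_def by (subst (asm) tendsto_at_iff_tendsto_nhds)
  have F_cont: "continuous_on S (F b)" for S b
    by (rule solution_pair_continuous[OF sol])
  define A where "A = {b. b \<ge> 0 \<and> (\<exists>r\<ge>0. F b r > a)}"
  define m where "m = Inf A"
  have A_bdd: "bdd_below A" by (auto simp: A_def)
  have "A \<noteq> {}"
  proof -
    \<comment> \<open>On [0, 1] the function \<open>(x\<^sup>2 + 1) * p b x + x\<close> is
      nondecreasing and x^2 + 1 \<le> 2, so the slope is at least (b - 1)/2 = a/2 + 1, which carries
      \<open>F\<close> from a/2 to at least a + 1.\<close>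
    define b where "b = a + 3"
    have b: "b \<ge> 3" using a a_pos unfolding b_def by linarith
    have p_ge: "p b r \<ge> (b - 1) / 2" if r: "0 \<le> r" "r \<le> 1" for r
    proof -
      have "(0\<^sup>2 + 1) * p b 0 + 0 \<le> (r\<^sup>2 + 1) * p b r + r"
      proof (rule DERIV_nonneg_imp_nondecreasing[OF r(1)])
        fix x
        have "((\<lambda>x. (x\<^sup>2 + 1) * p b x + x) has_real_derivative
            2 * x * p b x + (x\<^sup>2 + 1) * ((sin (2 * F b x) - 2 * x * p b x) / (x\<^sup>2 + 1)) + 1) (at x)"
          by (auto intro!: derivative_eq_intros solution_pairD[OF sol])
        then have "((\<lambda>x. (x\<^sup>2 + 1) * p b x + x) has_real_derivative sin (2 * F b x) + 1) (at x)"
          by simp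
        moreover have "sin (2 * F b x) + 1 \<ge> 0"
          using sin_ge_minus_one[of "2 * F b x"] by linarith
        ultimately show "\<exists>y. ((\<lambda>x. (x\<^sup>2 + 1) * p b x + x) has_real_derivative y) (at x) \<and> 0 \<le> y"
          by blast
      qed
      then have 1: "b - 1 \<le> (r\<^sup>2 + 1) * p b r" using r by (simp add: p0)
      then have "(r\<^sup>2 + 1) * p b r > 0" using b by linarith
      then have "p b r > 0" by (rule zero_less_mult_pos) simp
      moreover have "r\<^sup>2 + 1 \<le> 2" using r by (simp add: power_le_one)
      ultimately have "(r\<^sup>2 + 1) * p b r \<le> 2 * p b r" by (intro mult_right_mono) auto
      then show ?thesis using 1 by simp
    qed
    have "F b 0 - (b - 1) / 2 * 0 \<le> F b 1 - (b - 1) / 2 * 1"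
    proof (rule DERIV_nonneg_imp_nondecreasing[where f = "\<lambda>x. F b x - (b - 1) / 2 * x"])
      fix x :: real assume x: "0 \<le> x" "x \<le> 1"
      have "((\<lambda>x. F b x - (b - 1) / 2 * x) has_real_derivative p b x - (b - 1) / 2) (at x)"
        by (auto intro!: derivative_eq_intros solution_pairD[OF sol])
      then show "\<exists>y. ((\<lambda>x. F b x - (b - 1) / 2 * x) has_real_derivative y) (at x) \<and> 0 \<le> y"
        using p_ge[OF x] by (intro exI conjI) auto
    qed simp
    then have "F b 1 > a" by (simp add: F0 b_def field_simps)
    moreover have "b \<ge> 0" using b by simp
    ultimately have "b \<in> A" unfolding A_def by (intro CollectI conjI exI[of _ 1]) auto
    then show ?thesis by auto
  qed
  have m0: "m \<ge> 0"
    unfolding m_def using \<open>A \<noteq> {}\<close> by (intro cInf_greatest) (auto simp: A_def)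
  have near: "\<exists>b\<in>A. \<bar>b - m\<bar> < d" if d: "d > 0" for d
  proof -
    obtain b where b: "b \<in> A" "b < m + d"
      using cInf_lessD[OF \<open>A \<noteq> {}\<close>, of "m + d"] d unfolding m_def by auto
    moreover have "m \<le> b" unfolding m_def by (rule cInf_lower[OF b(1) A_bdd])
    ultimately show ?thesis by force
  qed
  have F_zero: "F 0 r = a / 2 \<and> p 0 r = 0" for r
    using solution_pair_unique[OF sol[of 0] solution_pair_const[of "a / 2"], of 0 r] sin_a
    by (simp add: F0 p0)
  \<comment> \<open>Exceeding \<open>a\<close> at a fixed time is an open condition on
    \<open>b\<close>, so a minimum of \<open>A\<close> would have smaller members of
    \<open>A\<close> beside it. These are still admissible slopes because \<open>m > 0\<close>:
    slope 0 gives the constant \<open>a / 2\<close>.\<close>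
  have m_notin: "m \<notin> A"
  proof
    assume "m \<in> A"
    then obtain r where r: "r \<ge> 0" "F m r > a" by (auto simp: A_def)
    have "m \<noteq> 0" using r F_zero[of r] a a_pos by (cases "m = 0") auto
    then have "\<forall>\<^sub>F b in nhds m. b > 0" using m0 by (intro eventually_nhds_in_open[of "{0<..}", simplified]) auto
    moreover have "\<forall>\<^sub>F b in nhds m. F b r > a"
      by (rule order_tendstoD(1)[OF cont_nhds r(2)])
    ultimately have "\<forall>\<^sub>F b in nhds m. b \<in> A"
      by eventually_elim (use r in \<open>auto simp: A_def\<close>)
    then obtain d where "d > 0" "\<And>b. \<bar>b - m\<bar> < d \<Longrightarrow> b \<in> A"
      by (auto simp: eventually_nhds_metric dist_real_def)
    then have "m - d / 2 \<in> A" by auto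
    from cInf_lower[OF this A_bdd] \<open>d > 0\<close> show False unfolding m_def by simp
  qed
  have lt: "F m r < a" if r: "r \<ge> 0" for r
  proof -
    have le: "F m r \<le> a" if "r \<ge> 0" for r
      using m_notin m0 that by (force simp: A_def)
    \<comment> \<open>Reaching \<open>a\<close> without exceeding it is tangential, so the data at
      that time are those of the rest point \<open>a\<close>.\<close>
    have "F m r \<noteq> a"
    proof
      assume eq: "F m r = a"
      then have "r \<noteq> 0" using F0[of m] a a_pos by auto
      then have "p m r = 0"
        using r le unfolding eq[symmetric]
        by (intro DERIV_local_max[OF solution_pairD(1)[OF sol], of r]) auto
      then have "F m 0 = a"
        using solution_pair_unique[OF sol[of m] solution_pair_const[of a], of r 0] sin_a eq
        by (simp add: sin_double)
      then show False using F0[of m] a a_pos by simp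
    qed
    then show ?thesis using le[OF r] by simp
  qed
  \<comment> \<open>Both alternatives are open in \<open>b\<close>, and both forbid reaching
    \<open>a\<close> after \<open>r1\<close>: a crossing has nonnegative energy, contradicting the
    first, and \<open>no_crossing\<close> excludes the second. Before \<open>r1\<close> nearby
    trajectories stay below \<open>a\<close> by compactness. Hence no slope near \<open>m\<close>
    would lie in \<open>A\<close>.\<close>
  have escape: "\<not> (energy (F m) (p m) r1 < 0 \<or> r1 \<ge> 1 \<and> F m r1 < a - pi / 3 \<and> energy (F m) (p m) r1 < 1 / 2)"
    if r1: "r1 \<ge> 0" for r1
  proof
    assume *: "energy (F m) (p m) r1 < 0 \<or> r1 \<ge> 1 \<and> F m r1 < a - pi / 3 \<and> energy (F m) (p m) r1 < 1 / 2"
    obtain s where s: "s \<in> {0..r1}" "\<And>r. r \<in> {0..r1} \<Longrightarrow> F m r \<le> F m s"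
      using continuous_attains_sup[of "{0..r1}" "F m"] F_cont r1 by auto
    have below: "\<forall>\<^sub>F b in nhds m. \<forall>r\<in>{0..r1}. F b r < a"
      unfolding eventually_nhds_metric
    proof (intro exI conjI allI impI ballI)
      \<comment> \<open>The smallest gap below \<open>a\<close> on \<open>{0..r1}\<close>, divided
        by the largest Lipschitz constant there.\<close>
      show "(a - F m s) / K r1 > 0" using lt[of s] s K by simp
      fix b r assume b: "dist b m < (a - F m s) / K r1" and r: "r \<in> {0..r1}"
      have "\<bar>F b r - F m r\<bar> \<le> \<bar>b - m\<bar> * K r" by (rule F_lip)
      also have "\<dots> \<le> \<bar>b - m\<bar> * K r1" using r by (intro mult_left_mono) (auto simp: K_def)
      also have "\<dots> < a - F m s" using b K[of r1] by (simp add: dist_real_def field_simps)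
      finally show "F b r < a" using s(2)[OF r] by simp
    qed
    have ev: "\<forall>\<^sub>F b in nhds m. energy (F b) (p b) r1 < e" if "energy (F m) (p m) r1 < e" for e
      by (rule order_tendstoD(2)[OF cont_energy_nhds that])
    have evF: "\<forall>\<^sub>F b in nhds m. F b r1 < e" if "F m r1 < e" for e
      by (rule order_tendstoD(2)[OF cont_nhds that])
    have "\<forall>\<^sub>F b in nhds m. energy (F b) (p b) r1 < 0 \<or>
        r1 \<ge> 1 \<and> F b r1 < a - pi / 3 \<and> energy (F b) (p b) r1 < 1 / 2"
      using *
    proof (elim disjE conjE)
      assume "energy (F m) (p m) r1 < 0"
      from ev[OF this] show ?thesis by eventually_elim simp
    next
      assume "r1 \<ge> 1" and e: "F m r1 < a - pi / 3" "energy (F m) (p m) r1 < 1 / 2"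
      from evF[OF e(1)] ev[OF e(2)] show ?thesis
        by eventually_elim (use \<open>r1 \<ge> 1\<close> in simp)
    qed
    with below have "\<forall>\<^sub>F b in nhds m. b \<notin> A"
    proof eventually_elim
      case (elim b)
      show ?case
      proof
        assume "b \<in> A"
        then obtain r where r: "r \<ge> 0" "F b r > a" by (auto simp: A_def)
        then have "r > r1" using elim(1) by force
        then obtain r2 where r2: "r1 \<le> r2" "r2 \<le> r" "F b r2 = a"
          using IVT'[of "F b" r1 a r] elim(1) r1 r F_cont by force
        have "energy (F b) (p b) r2 \<ge> 0" using r2 sin_a by (simp add: energy_def)
        then show False
          using elim(2) energy_antimono[OF sol[of b] r1 r2(1)] no_crossing[OF sol[of b] _ r2(1), of n] r2(3)
          by (auto simp: a_def)
      qed
    qed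
    then show False using near by (auto simp: eventually_nhds_metric dist_real_def)
  qed
  have "m \<noteq> 0"
  proof
    assume "m = 0"
    \<comment> \<open>For \<open>m = 0\<close> the constant \<open>a / 2\<close> meets the second
      alternative at time 1: its energy is at most 0, and a/2 < a - pi/3 because a \<ge> pi.\<close>
    then show False
      using escape[of 1] F_zero[of 1] a pi_gt3 by (auto simp: energy_def)
  qed
  with m0 have m: "m > 0" by simp
  have e_pos: "energy (F m) (p m) r > 0" if "r \<ge> 0" for r
  proof (rule ccontr)
    assume "\<not> energy (F m) (p m) r > 0"
    then have "energy (F m) (p m) r = 0" using escape[OF that] by force
    moreover have "energy (F m) (p m) s \<ge> 0" if "s > r" for s
      using escape[of s] that \<open>r \<ge> 0\<close> by force
    ultimately have "p m 0 = 0"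
      using energy_zero_imp_const(2)[OF sol that] by blast
    then show False using m p0 by simp
  qed
  have p_pos: "p m r > 0" if r: "r \<ge> 0" for r
  proof (rule ccontr)
    assume "\<not> p m r > 0"
    then have "\<exists>x\<ge>0. x \<le> r \<and> p m x = 0"
      using m p0[of m] r by (intro IVT2' solution_pair_continuous(2)[OF sol]) auto
    then obtain x where "0 \<le> x" "p m x = 0" by blast
    then show False using energy_pos_imp_deriv_nz[OF e_pos] by blast
  qed
  have mono: "F m r \<le> F m s" if "0 \<le> r" "r \<le> s" for r s
  proof (rule DERIV_nonneg_imp_nondecreasing[OF that(2)])
    fix x assume "r \<le> x" "x \<le> s"
    then show "\<exists>y. (F m has_real_derivative y) (at x) \<and> 0 \<le> y"
      using that(1) p_pos[of x] by (intro exI[of _ "p m x"] conjI solution_pairD(1)[OF sol]) auto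
  qed
  \<comment> \<open>Boundedness of \<open>F m\<close> prevents
    \<open>p m r * (r + 1) \<ge> c\<close> for all large \<open>r\<close>, so at some time the
    kinetic part is below c^2/2 \<le> 1/2. By \<open>escape\<close> the trajectory is then already
    in the last pi/3. If it were still \<open>e\<close> below \<open>a\<close>, sin^2 would be at
    least c^2 and the energy negative, which \<open>escape\<close> excludes too.\<close>
  have reach: "\<exists>r\<ge>0. F m r > a - e" if e: "0 < e" "e < pi / 3" for e
  proof (rule ccontr)
    assume "\<not> ?thesis"
    then have le: "F m r \<le> a - e" if "r \<ge> 0" for r using that by force
    define c where "c = sin e"
    have c: "0 < c" "c \<le> 1" unfolding c_def using e by (auto intro!: sin_gt_zero)
    have "\<exists>r\<ge>1. p m r * (r + 1) < c"
    proof (rule ccontr)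
      assume "\<not> ?thesis"
      then have "\<exists>r\<ge>1. F m r > a"
        using solution_pairD(1)[OF sol[of m]] c
        by (intro deriv_ge_reciprocal_imp_unbounded[where p = "p m" and c = c]) force+
      then obtain r where "r \<ge> 1" "F m r > a" by blast
      then show False using lt[of r] by simp
    qed
    then obtain r where r: "r \<ge> 1" "p m r * (r + 1) < c" by blast
    have "(r\<^sup>2 + 1) * (p m r)\<^sup>2 \<le> (p m r * (r + 1))\<^sup>2"
    proof -
      have "r\<^sup>2 + 1 \<le> (r + 1)\<^sup>2" using r by (simp add: power2_eq_square algebra_simps)
      then show ?thesis unfolding power_mult_distrib mult.commute[of "(p m r)\<^sup>2"]
        by (intro mult_right_mono) auto
    qed
    also have "\<dots> < c\<^sup>2"
      using r p_pos[of r] by (intro power_strict_mono) auto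
    finally have small: "(r\<^sup>2 + 1) * (p m r)\<^sup>2 < c\<^sup>2" .
    have "c\<^sup>2 \<le> 1" using c by (simp add: power_le_one)
    then have "energy (F m) (p m) r < 1 / 2"
      using small zero_le_power2[of "sin (F m r)"] unfolding energy_def by linarith
    then have "F m r \<ge> a - pi / 3" using escape[of r] r by force
    then have "c \<le> sin (a - F m r)"
      unfolding c_def using le[of r] r e by (intro sin_monotone_2pi_le) auto
    then have "c\<^sup>2 \<le> (sin (a - F m r))\<^sup>2" using c by (intro power_mono) auto
    also have "\<dots> = (sin (F m r))\<^sup>2"
      unfolding a_def by (simp add: sin_diff power_mult_distrib flip: power_mult)
    finally have "c\<^sup>2 \<le> (sin (F m r))\<^sup>2" .
    moreover have "c\<^sup>2 > 0" using c by simp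
    ultimately have "energy (F m) (p m) r < 0" using small unfolding energy_def by linarith
    then show False using escape[of r] r by simp
  qed
  have "(F m \<longlongrightarrow> a) at_top"
  proof (rule tendstoI)
    fix e :: real assume "e > 0"
    moreover have "min e 1 < pi / 3" using pi_gt3 by linarith
    ultimately obtain r where r: "r \<ge> 0" "F m r > a - min e 1"
      using reach[of "min e 1"] by auto
    show "\<forall>\<^sub>F x in at_top. dist (F m x) a < e"
      using eventually_ge_at_top[of r]
    proof eventually_elim
      case (elim x)
      then show ?case using mono[OF r(1) elim] lt[of x] r by (auto simp: dist_real_def)
    qed
  qed
  then show ?thesis using that[of "F m" "p m"] sol F0 by (simp add: a_def)
qed

text \<open>The shooting solution and its reflection have the same value and slope at 0, so they
  coincide.\<close>

lemma solution_exists: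
  assumes "n \<ge> 1"
  obtains F p where "solution_pair F p" "(F \<longlongrightarrow> 0) at_bot" "(F \<longlongrightarrow> real n * pi) at_top"
proof -
  obtain F p where F: "solution_pair F p" "F 0 = real n * pi / 2" "(F \<longlongrightarrow> real n * pi) at_top"
    using shooting[OF assms] .
  have sym: "F r = real n * pi - F (- r)" for r
    using solution_pair_unique(1)[OF F(1) solution_pair_reflect[OF F(1), of n], of 0 r] F(2) by simp
  have "((\<lambda>r. real n * pi - F r) \<longlongrightarrow> real n * pi - real n * pi) at_top"
    by (intro tendsto_intros F(3))
  then have "(F \<longlongrightarrow> 0) at_bot"
    unfolding filterlim_at_bot_mirror using sym by (metis (no_types, lifting) diff_self ext minus_minus)
  then show ?thesis using that F by blast
qed

section \<open>Monotonicity and asymptotics\<close>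

text \<open>The form of \<open>smooth_solution\<close> that carries the derivative explicitly; the
  equation itself supplies smoothness, so the two notions agree.\<close>

definition connects :: "nat \<Rightarrow> (real \<Rightarrow> real) \<Rightarrow> (real \<Rightarrow> real) \<Rightarrow> bool" where
  "connects n F p \<longleftrightarrow>
    solution_pair F p \<and> (F \<longlongrightarrow> 0) at_bot \<and> (F \<longlongrightarrow> real n * pi) at_top"

lemma connects_reflect:
  assumes "connects n F p"
  shows "connects n (\<lambda>r. real n * pi - F (- r)) (\<lambda>r. p (- r))"
proof -
  have "((\<lambda>r. real n * pi - F (- r)) \<longlongrightarrow> real n * pi - 0) at_top"
    using assms unfolding connects_def filterlim_at_bot_mirror by (intro tendsto_intros) auto
  moreover have "((\<lambda>r. real n * pi - F r) \<longlongrightarrow> real n * pi - real n * pi) at_top"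
    using assms unfolding connects_def by (intro tendsto_intros) auto
  ultimately show ?thesis
    using assms solution_pair_reflect unfolding connects_def filterlim_at_bot_mirror by simp
qed

lemma connects_energy_nonneg:
  assumes "connects n F p"
  shows "energy F p r \<ge> 0"
proof -
  have *: "energy F p r \<ge> 0" if con: "connects n F p" and r: "r \<ge> 0" for F p r
  proof (rule tendsto_upperbound)
    have "((\<lambda>s. - (sin (F s))\<^sup>2) \<longlongrightarrow> - (sin (real n * pi))\<^sup>2) at_top"
      using con unfolding connects_def by (intro tendsto_intros) auto
    then show "((\<lambda>s. - (sin (F s))\<^sup>2) \<longlongrightarrow> 0) at_top" by simp
    show "\<forall>\<^sub>F s in at_top. - (sin (F s))\<^sup>2 \<le> energy F p r"
      using eventually_ge_at_top[of r]
    proof eventually_elim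
      case (elim s)
      then show ?case
        using sin_sq_le_energy[of F s p] energy_antimono[of F p r s] con r by (simp add: connects_def)
    qed
  qed simp
  show ?thesis
    using *[OF assms] *[OF connects_reflect[OF assms], of "- r"] energy_reflect[of n F p "- r"]
    by (cases "r \<ge> 0") auto
qed

lemma connects_energy_zero_imp_const:
  assumes con: "connects n F p" and e: "energy F p r = 0"
  shows "F t = F r"
proof -
  have *: "F t = F r" if con: "connects n F p" and r: "r \<ge> 0" and e: "energy F p r = 0" for F p r t
    using energy_zero_imp_const(1)[OF _ r e] connects_energy_nonneg[OF con] con
    by (auto simp: connects_def)
  show ?thesis
    using *[OF con _ e, of t] *[OF connects_reflect[OF con], of "- r" "- t"]
      energy_reflect[of n F p "- r"] e
    by (cases "r \<ge> 0") auto
qed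

lemma strict_mono_between_limits:
  fixes f :: "real \<Rightarrow> real"
  assumes f: "strict_mono f" and bot: "(f \<longlongrightarrow> a) at_bot" and top: "(f \<longlongrightarrow> b) at_top"
  shows "a < f r" "f r < b"
proof -
  have "f (r + 1) \<le> b"
    using eventually_ge_at_top[of "r + 1"]
    by (intro tendsto_lowerbound[OF top]) (auto elim!: eventually_mono simp: strict_mono_less_eq[OF f])
  then show "f r < b" using strict_monoD[OF f, of r "r + 1"] by simp
  have "a \<le> f (r - 1)"
    using eventually_le_at_bot[of "r - 1"]
    by (intro tendsto_upperbound[OF bot]) (auto elim!: eventually_mono simp: strict_mono_less_eq[OF f])
  then show "a < f r" using strict_monoD[OF f, of "r - 1" r] by simp
qed

lemma strict_mono_deriv_pos:
  fixes f f' :: "real \<Rightarrow> real"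
  assumes "\<And>x. (f has_real_derivative f' x) (at x)" "\<And>x. f' x > 0"
  shows "strict_mono f"
  by (rule strict_monoI, rule DERIV_pos_imp_increasing) (use assms in blast)+

text \<open>The third case, \<open>p\<close> negative everywhere, contradicts the order 0 \<le> n pi
  of the limits. Without a zero of the energy \<open>p\<close> has no zero, hence one sign.\<close>

lemma connects_trichotomy:
  assumes con: "connects n F p"
  obtains (const) "\<And>t. F t = 0" "n = 0" | (mono) "\<And>r. p r > 0" "strict_mono F" "n \<ge> 1"
proof (cases "\<exists>r. energy F p r = 0")
  case True
  then obtain r where r: "energy F p r = 0" by blast
  obtain c where c: "F = (\<lambda>_. c)" using connects_energy_zero_imp_const[OF con r] by blast
  have "c = 0" "c = real n * pi"
    using con unfolding connects_def c by (auto simp: tendsto_const_iff)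
  then show ?thesis using const c by auto
next
  case False
  have der: "(F has_real_derivative p r) (at r)" for r
    using con by (auto simp: connects_def dest: solution_pairD)
  have nz: "p r \<noteq> 0" for r
    using False connects_energy_nonneg[OF con, of r] by (intro energy_pos_imp_deriv_nz[of F]) (auto simp: less_le)
  have p_cont: "continuous_on S p" for S
    using con by (auto simp: connects_def dest: solution_pair_continuous)
  have "(\<forall>r. p r > 0) \<or> (\<forall>r. p r < 0)"
  proof (rule ccontr)
    assume "\<not> ?thesis"
    then obtain r s where rs: "p r < 0" "p s > 0"
      using nz by (meson linorder_neqE_linordered_idom)
    have "connected (p ` UNIV)" by (intro connected_continuous_image p_cont) auto
    then have "0 \<in> range p"
      using rs unfolding connected_iff_interval by (meson less_imp_le rangeI)
    then show False using nz by auto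
  qed
  then show ?thesis
  proof
    assume pos: "\<forall>r. p r > 0"
    then have sm: "strict_mono F" using der by (intro strict_mono_deriv_pos) auto
    then have "0 < F 0" "F 0 < real n * pi"
      using strict_mono_between_limits[OF sm] con by (auto simp: connects_def)
    then have "real n * pi > 0" by linarith
    then have "n \<ge> 1" by (cases n) auto
    then show ?thesis using mono pos sm by auto
  next
    assume neg: "\<forall>r. p r < 0"
    have "strict_mono (\<lambda>r. - F r)"
      by (rule strict_mono_deriv_pos[where f' = "\<lambda>r. - p r"]) (use neg in \<open>auto intro!: derivative_eq_intros der\<close>)
    moreover have "((\<lambda>r. - F r) \<longlongrightarrow> - 0) at_bot" "((\<lambda>r. - F r) \<longlongrightarrow> - (real n * pi)) at_top"
      using con unfolding connects_def by (blast intro: tendsto_minus)+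
    ultimately have "- 0 < - F 0" "- F 0 < - (real n * pi)"
      by (rule strict_mono_between_limits)+
    then have "- (real n * pi) > 0" by linarith
    moreover have "real n * pi \<ge> 0" by simp
    ultimately show ?thesis by linarith
  qed
qed

lemma connects_pos:
  assumes "connects n F p" "n \<ge> 1"
  shows "p r > 0" "strict_mono F" "0 < F r" "F r < real n * pi"
proof -
  have *: "(\<forall>r. p r > 0) \<and> strict_mono F"
    using assms by (cases rule: connects_trichotomy[OF assms(1)]) auto
  then show "p r > 0" "strict_mono F" by auto
  have lim: "(F \<longlongrightarrow> 0) at_bot" "(F \<longlongrightarrow> real n * pi) at_top"
    using assms(1) by (auto simp: connects_def)
  show "0 < F r" "F r < real n * pi"
    using strict_mono_between_limits[OF _ lim] * by blast+
qed

section \<open>Decay at infinity\<close>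

lemma deriv_nonneg_imp_le_limit:
  fixes f f' :: "real \<Rightarrow> real"
  assumes "\<And>x. x \<ge> R \<Longrightarrow> (f has_real_derivative f' x) (at x)" "\<And>x. x \<ge> R \<Longrightarrow> f' x \<ge> 0"
    and lim: "(f \<longlongrightarrow> L) at_top" and r: "r \<ge> R"
  shows "f r \<le> L"
proof (rule tendsto_lowerbound[OF lim])
  show "\<forall>\<^sub>F x in at_top. f r \<le> f x"
    using eventually_ge_at_top[of r]
  proof eventually_elim
    case (elim x)
    then show ?case
      by (rule DERIV_nonneg_imp_nondecreasing) (use assms(1,2) r in \<open>meson order_trans\<close>)
  qed
qed simp

lemma deriv_divide_power:
  fixes c :: real
  assumes "r \<noteq> 0" "k \<ge> 1"
  shows "((\<lambda>r. c / r ^ k) has_real_derivative - (real k * c) / r ^ (k + 1)) (at r)"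
proof -
  have "((\<lambda>r. c / r ^ k) has_real_derivative - (c * (real k * r ^ (k - 1))) / (r ^ k * r ^ k)) (at r)"
    using assms(1) by (auto intro!: derivative_eq_intros)
  also have "- (c * (real k * r ^ (k - 1))) / (r ^ k * r ^ k) = - (real k * c) / r ^ (k + 1)"
    using assms by (cases k) (auto simp: divide_simps)
  finally show ?thesis .
qed

lemma tendsto_divide_power_at_top:
  fixes c :: real
  assumes "k \<ge> 1"
  shows "((\<lambda>r. c / r ^ k) \<longlongrightarrow> 0) at_top"
  using assms by (intro real_tendsto_divide_at_top[OF tendsto_const] filterlim_pow_at_top filterlim_ident) auto

text \<open>Up to sign, the Wronskian of \<open>u = n\<pi> - F\<close> with the solution \<open>r\<close> of the equation linearised at
  infinity has derivative \<open>r (2u - sin 2u) = O(r u\<^sup>3)\<close>, so it converges; its limit is \<open>3\<alpha>\<close>.\<close>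
lemma connects_asymptotics:
  assumes con: "connects n F p" and n: "n \<ge> 1"
  obtains \<alpha> D R where "\<alpha> > 0" "R \<ge> 1" "D \<ge> 0"
    "\<And>r. r \<ge> R \<Longrightarrow> real n * pi - F r \<le> \<alpha> / r ^ 2"
    "\<And>r. r \<ge> R \<Longrightarrow> real n * pi - F r \<ge> \<alpha> / r ^ 2 - D / r ^ 4"
    "\<And>r. r \<ge> R \<Longrightarrow> \<bar>p r - 2 * \<alpha> / r ^ 3\<bar> \<le> 2 * D / r ^ 5"
proof -
  define u where "u r = real n * pi - F r" for r
  have sol: "solution_pair F p" and lim: "(F \<longlongrightarrow> real n * pi) at_top"
    using con by (auto simp: connects_def)
  note pos = connects_pos[OF con n]
  have u: "u r > 0" for r using pos(4) by (simp add: u_def)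
  have u_der: "(u has_real_derivative - p r) (at r)" for r
    unfolding u_def by (auto intro!: derivative_eq_intros solution_pairD[OF sol])
  have u_lim: "(u \<longlongrightarrow> 0) at_top"
    unfolding u_def using tendsto_diff[OF tendsto_const lim, of "real n * pi"] by simp
  have sin_F: "sin (2 * F r) = - sin (2 * u r)" for r
    using sin_diff[of "real (2 * n) * pi" "2 * u r"] unfolding sin_npi cos_npi
    by (simp add: u_def algebra_simps)
  have P_der: "((\<lambda>r. (r\<^sup>2 + 1) * p r) has_real_derivative - sin (2 * u r)) (at r)" for r
  proof -
    have "((\<lambda>r. (r\<^sup>2 + 1) * p r) has_real_derivative
        2 * r * p r + (r\<^sup>2 + 1) * ((sin (2 * F r) - 2 * r * p r) / (r\<^sup>2 + 1))) (at r)"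
      by (auto intro!: derivative_eq_intros solution_pairD[OF sol])
    then show ?thesis by (simp add: sin_F)
  qed
  have "\<forall>\<^sub>F r in at_top. u r < pi / 2"
    by (intro order_tendstoD[OF u_lim]) auto
  then obtain R0 where R0: "\<And>r. r \<ge> R0 \<Longrightarrow> u r < pi / 2"
    by (auto simp: eventually_at_top_linorder)
  define R where "R = max 1 R0"
  have R: "R \<ge> 1" "\<And>r. r \<ge> R \<Longrightarrow> u r < pi / 2"
    using R0 by (auto simp: R_def)
  define M where "M = (R\<^sup>2 + 1) * p R"
  have M: "M > 0" unfolding M_def using pos(1) by simp
  have p_le: "p r \<le> M / r ^ 2" if r: "r \<ge> R" for r
  proof -
    have "(r\<^sup>2 + 1) * p r \<le> M"
      unfolding M_def
    proof (rule DERIV_nonpos_imp_nonincreasing[OF r])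
      fix x assume "R \<le> x" "x \<le> r"
      then have "sin (2 * u x) > 0" using u[of x] R(2)[of x] by (intro sin_gt_zero) auto
      then show "\<exists>y. ((\<lambda>r. (r\<^sup>2 + 1) * p r) has_real_derivative y) (at x) \<and> y \<le> 0"
        by (intro exI[of _ "- sin (2 * u x)"] conjI P_der) simp
    qed
    moreover have "r\<^sup>2 * p r \<le> (r\<^sup>2 + 1) * p r"
      using pos(1)[of r] by (intro mult_right_mono) auto
    ultimately show ?thesis using r R(1) by (simp add: pos_le_divide_eq mult.commute)
  qed
  have u_le1: "u r \<le> M / r ^ 1" if r: "r \<ge> R" for r
  proof -
    \<comment> \<open>Integration from infinity: a function with nonnegative derivative stays below
      its limit. The bound u = O(1/r) obtained here makes r u^3 integrable.\<close>
    have "u r - M / r ^ 1 \<le> 0 - 0"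
    proof (rule deriv_nonneg_imp_le_limit[OF _ _ _ r])
      fix x assume x: "x \<ge> R"
      show "((\<lambda>r. u r - M / r ^ 1) has_real_derivative - p x - - (real 1 * M) / x ^ (1 + 1)) (at x)"
        using x R(1) by (intro derivative_intros u_der deriv_divide_power) auto
      show "- p x - - (real 1 * M) / x ^ (1 + 1) \<ge> 0"
        using p_le[OF x] by (simp add: numeral_2_eq_2)
    qed (intro tendsto_intros u_lim tendsto_divide_power_at_top order_refl)
    then show ?thesis by simp
  qed
  \<comment> \<open>The Wronskian of \<open>u\<close> and r, up to sign. As r solves ((r^2+1) v')' =
    2 v exactly, the linear part drops out of the derivative and only the cubic remainder of sin
    survives.\<close>
  define j where "j r = (r\<^sup>2 + 1) * (r * p r + u r)" for r
  have j_pos: "j r > 0" if "r \<ge> R" for r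
    unfolding j_def using that R(1) pos(1)[of r] u[of r] by (intro mult_pos_pos add_pos_pos) auto
  have j_der: "(j has_real_derivative r * (2 * u r - sin (2 * u r))) (at r)" for r
  proof -
    have "((\<lambda>r. r * ((r\<^sup>2 + 1) * p r) + (r\<^sup>2 + 1) * u r) has_real_derivative
        (1 * ((r\<^sup>2 + 1) * p r) + - sin (2 * u r) * r) + (2 * r * u r + - p r * (r\<^sup>2 + 1))) (at r)"
      by (intro DERIV_add DERIV_mult DERIV_ident P_der u_der) (auto intro!: derivative_eq_intros)
    then have "((\<lambda>r. r * ((r\<^sup>2 + 1) * p r) + (r\<^sup>2 + 1) * u r) has_real_derivative
        r * (2 * u r - sin (2 * u r))) (at r)"
      by (simp add: algebra_simps)
    moreover have "j = (\<lambda>r. r * ((r\<^sup>2 + 1) * p r) + (r\<^sup>2 + 1) * u r)"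
      by (auto simp: j_def algebra_simps)
    ultimately show ?thesis by simp
  qed
  have j'_nonneg: "r * (2 * u r - sin (2 * u r)) \<ge> 0" if "r \<ge> R" for r
    using that R(1) u[of r] sin_x_le_x[of "2 * u r"] by (intro mult_nonneg_nonneg) auto
  \<comment> \<open>The exponents express r (r^-i)^3 = r^-(k+1). Used with i = 1, k = 1 for
    boundedness of \<open>j\<close>, and with i = 2, k = 4 once the sharp decay is known.\<close>
  have j'_le: "r * (2 * u r - sin (2 * u r)) \<le> 8 * c ^ 3 / r ^ (k + 1)"
    if r: "r \<ge> R" and c: "u r \<le> c / r ^ i" and k: "3 * i = k + 2" for r c i k
  proof -
    have "2 * u r - sin (2 * u r) \<le> (2 * u r) ^ 3 / 6"
      using Maclaurin_sin_bound[of "2 * u r" 3] u[of r]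
        abs_ge_minus_self[of "sin (2 * u r) - 2 * u r"]
      by (simp add: numeral_3_eq_3 sin_coeff_def fact_numeral)
    also have "\<dots> \<le> (2 * u r) ^ 3" using u[of r] by simp
    also have "\<dots> = 8 * u r ^ 3" by (simp add: power_mult_distrib)
    also have "\<dots> \<le> 8 * (c / r ^ i) ^ 3" using c u[of r] by (intro mult_left_mono power_mono) auto
    also have "\<dots> = 8 * c ^ 3 / (r ^ (k + 2))"
      unfolding power_divide by (metis k mult.commute power_mult times_divide_eq_right)
    finally have "r * (2 * u r - sin (2 * u r)) \<le> r * (8 * c ^ 3 / r ^ (k + 2))"
      using r R(1) by (intro mult_left_mono) auto
    also have "\<dots> = 8 * c ^ 3 / r ^ (k + 1)"
      using r R(1) by simp
    finally show ?thesis .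
  qed
  have j_mono: "j r \<le> j s" if "R \<le> r" "r \<le> s" for r s
    by (rule DERIV_nonneg_imp_nondecreasing[OF that(2)])
      (use that j_der j'_nonneg in \<open>meson order_trans\<close>)
  have j_bdd: "j r \<le> j R + 8 * M ^ 3 / R ^ 1" if r: "r \<ge> R" for r
  proof -
    have "j r + 8 * M ^ 3 / r ^ 1 \<le> j R + 8 * M ^ 3 / R ^ 1"
    proof (rule DERIV_nonpos_imp_nonincreasing[OF r])
      fix x assume x: "R \<le> x" "x \<le> r"
      have "((\<lambda>r. j r + 8 * M ^ 3 / r ^ 1) has_real_derivative
          x * (2 * u x - sin (2 * u x)) + - (real 1 * (8 * M ^ 3)) / x ^ (1 + 1)) (at x)"
        using x R(1) by (intro derivative_intros j_der deriv_divide_power) auto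
      moreover have "x * (2 * u x - sin (2 * u x)) + - (real 1 * (8 * M ^ 3)) / x ^ (1 + 1) \<le> 0"
        using j'_le[OF x(1) u_le1[OF x(1)], of 1] by simp
      ultimately show "\<exists>y. ((\<lambda>r. j r + 8 * M ^ 3 / r ^ 1) has_real_derivative y) (at x) \<and> y \<le> 0" by blast
    qed
    moreover have "8 * M ^ 3 / r ^ 1 \<ge> 0" using M r R(1) by simp
    ultimately show ?thesis by linarith
  qed
  define l where "l = (SUP r\<in>{R..}. j r)"
  have bdd: "bdd_above (j ` {R..})" using j_bdd by (auto intro!: bdd_aboveI2)
  have j_le: "j r \<le> l" if "r \<ge> R" for r
    unfolding l_def using that by (intro cSUP_upper bdd) auto
  have l: "l > 0" using j_le[of R] j_pos[of R] by linarith
  have j_lim: "(j \<longlongrightarrow> l) at_top"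
  proof (rule tendstoI)
    fix e :: real assume "e > 0"
    then obtain s where s: "s \<ge> R" "j s > l - e"
      using less_cSUP_iff[OF _ bdd, of "l - e"] by (auto simp: l_def)
    show "\<forall>\<^sub>F r in at_top. dist (j r) l < e"
      using eventually_ge_at_top[of s]
      by eventually_elim (use s j_mono j_le in \<open>force simp: dist_real_def\<close>)
  qed
  \<comment> \<open>The derivative of u/r is \<open>- j r / (r ^ 2 * (r ^ 2 + 1))\<close>, close to
    - l r^-4; integrated from infinity this gives u/r close to l r^-3 / 3.\<close>
  define \<alpha> where "\<alpha> = l / 3"
  have \<alpha>: "\<alpha> > 0" "l = 3 * \<alpha>" using l by (auto simp: \<alpha>_def)
  have ur_der: "((\<lambda>r. u r / r) has_real_derivative - j r / (r ^ 2 * (r ^ 2 + 1))) (at r)" if "r \<ge> R" for r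
  proof -
    have "((\<lambda>r. u r / r) has_real_derivative (- p r * r - u r) / (r * r)) (at r)"
      using that R(1) by (auto intro!: derivative_eq_intros u_der)
    also have "(- p r * r - u r) / (r * r) = - j r / (r ^ 2 * (r ^ 2 + 1))"
    proof -
      have "j r / (r ^ 2 * (r ^ 2 + 1)) = (r * p r + u r) / r ^ 2"
        unfolding j_def by simp
      moreover have "(- p r * r - u r) / (r * r) = - ((r * p r + u r) / r ^ 2)"
        by (simp add: power2_eq_square minus_divide_left algebra_simps)
      ultimately show ?thesis by simp
    qed
    finally show ?thesis .
  qed
  have ur_lim: "((\<lambda>r. u r / r) \<longlongrightarrow> 0) at_top"
    by (rule real_tendsto_divide_at_top[OF u_lim filterlim_ident])
  have cancel: "a \<le> b" if "a / r \<le> b / r" "r \<ge> R" for a b r :: real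
    using that R(1) by (simp add: divide_le_cancel)
  have u_le: "u r \<le> \<alpha> / r ^ 2" if r: "r \<ge> R" for r
  proof -
    have "u r / r - \<alpha> / r ^ 3 \<le> 0 - 0"
    proof (rule deriv_nonneg_imp_le_limit[OF _ _ _ r])
      fix x assume x: "x \<ge> R"
      show "((\<lambda>r. u r / r - \<alpha> / r ^ 3) has_real_derivative
          - j x / (x ^ 2 * (x ^ 2 + 1)) - - (real 3 * \<alpha>) / x ^ (3 + 1)) (at x)"
        using x R(1) by (intro derivative_intros ur_der deriv_divide_power) auto
      have "j x / (x ^ 2 * (x ^ 2 + 1)) \<le> l / x ^ 4"
        using j_le[OF x] l x R(1) by (intro frac_le) (auto simp: power4_eq_xxxx power2_eq_square algebra_simps)
      then show "- j x / (x ^ 2 * (x ^ 2 + 1)) - - (real 3 * \<alpha>) / x ^ (3 + 1) \<ge> 0"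
        by (simp add: \<alpha>)
    qed (intro tendsto_intros ur_lim tendsto_divide_power_at_top, simp)
    then have "u r / r \<le> \<alpha> / r ^ 2 / r" by (simp add: numeral_3_eq_3 power2_eq_square mult.assoc)
    then show ?thesis by (rule cancel[OF _ r])
  qed
  \<comment> \<open>The second pass: with u \<le> \<alpha> r^-2 the derivative of \<open>j\<close>
    is at most 8 \<alpha>^3 r^-5, whose integral from r to infinity is 2 \<alpha>^3 r^-4.\<close>
  have j_ge: "j r \<ge> l - 2 * \<alpha> ^ 3 / r ^ 4" if r: "r \<ge> R" for r
  proof -
    have "- (j r + 2 * \<alpha> ^ 3 / r ^ 4) \<le> - (l + 0)"
    proof (rule deriv_nonneg_imp_le_limit[OF _ _ _ r])
      fix x assume x: "x \<ge> R"
      show "((\<lambda>r. - (j r + 2 * \<alpha> ^ 3 / r ^ 4)) has_real_derivative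
          - (x * (2 * u x - sin (2 * u x)) + - (real 4 * (2 * \<alpha> ^ 3)) / x ^ (4 + 1))) (at x)"
        using x R(1) by (intro derivative_intros j_der deriv_divide_power) auto
      show "- (x * (2 * u x - sin (2 * u x)) + - (real 4 * (2 * \<alpha> ^ 3)) / x ^ (4 + 1)) \<ge> 0"
        using j'_le[OF x u_le[OF x], of 4] by simp
    qed (intro tendsto_intros j_lim tendsto_divide_power_at_top, simp)
    then show ?thesis by simp
  qed
  \<comment> \<open>With q = r^-2, the product (l - 2 \<alpha>^3 q^2) (q - q^2) loses l q^2 from
    replacing 1/(r^2+1) by its lower bound, and at most 2 \<alpha>^3 q^2 from the tail of
    \<open>j\<close>, since q \<le> 1.\<close>
  define D where "D = 2 * \<alpha> ^ 3 + l"
  have D: "D > 0" unfolding D_def using \<alpha>(1) l by (intro add_pos_pos) auto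
  have inv_ge: "1 / (r ^ 2 + 1) \<ge> 1 / r ^ 2 - 1 / r ^ 4" "1 / r ^ 2 - 1 / r ^ 4 \<ge> 0" if r: "r \<ge> R" for r
  proof -
    define q where "q = r ^ 2"
    have q: "q \<ge> 1" "r ^ 4 = q * q"
      using r R(1) one_le_power[of r 2] by (auto simp: q_def power4_eq_xxxx power2_eq_square)
    have "1 / q - 1 / (q * q) = (q - 1) / (q * q)" using q by (simp add: field_simps)
    moreover have "(q - 1) / (q * q) \<le> 1 / (q + 1)"
      using q by (simp add: pos_divide_le_eq pos_le_divide_eq) (simp add: algebra_simps)
    ultimately show "1 / (r ^ 2 + 1) \<ge> 1 / r ^ 2 - 1 / r ^ 4" "1 / r ^ 2 - 1 / r ^ 4 \<ge> 0"
      using q by (auto simp flip: q_def)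
  qed
  have j_quot_ge: "j r / (r ^ 2 + 1) \<ge> l / r ^ 2 - D / r ^ 4" if r: "r \<ge> R" for r
  proof -
    define q where "q = 1 / r ^ 2"
    have q: "0 < q" "q \<le> 1" "1 / r ^ 4 = q * q"
      using r R(1) one_le_power[of r 2] by (auto simp: q_def divide_le_eq simp flip: power_add)
    have le: "j r * (1 / (r ^ 2 + 1)) \<ge> (l - 2 * \<alpha> ^ 3 * (q * q)) * (q - q * q)"
    proof -
      have "(l - 2 * \<alpha> ^ 3 * (q * q)) * (q - q * q) \<le> j r * (q - q * q)"
      proof (intro mult_right_mono)
        show "l - 2 * \<alpha> ^ 3 * (q * q) \<le> j r"
          using j_ge[OF r] unfolding q(3)[symmetric] by simp
        show "0 \<le> q - q * q" using q by (simp add: mult_left_le)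
      qed
      also have "\<dots> \<le> j r * (1 / (r ^ 2 + 1))"
        using inv_ge(1)[OF r] j_pos[OF r] unfolding q(3) q_def[symmetric] by (intro mult_left_mono) auto
      finally show ?thesis .
    qed
    have "q * q * q \<le> q * q * 1" using q by (intro mult_left_mono) auto
    then have "2 * \<alpha> ^ 3 * (q * q * q) \<le> 2 * \<alpha> ^ 3 * (q * q)"
      using \<alpha> by (intro mult_left_mono) auto
    moreover have "2 * \<alpha> ^ 3 * (q * q * q * q) \<ge> 0" using \<alpha> q by simp
    ultimately have "l * q - D * (q * q) \<le> (l - 2 * \<alpha> ^ 3 * (q * q)) * (q - q * q)"
      unfolding D_def by (simp add: algebra_simps)
    then have "l * q - D * (1 / r ^ 4) \<le> j r * (1 / (r ^ 2 + 1))" using le q by simp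
    then show ?thesis by (simp add: q_def)
  qed
  have u_ge: "u r \<ge> \<alpha> / r ^ 2 - D / r ^ 4" if r: "r \<ge> R" for r
  proof -
    \<comment> \<open>The factor 1/5 comes from integrating r^-6; it is given up at the end so that
      one \<open>D\<close> serves both bounds.\<close>
    have "- (u r / r - \<alpha> / r ^ 3 + D / 5 / r ^ 5) \<le> - (0 - 0 + 0)"
    proof (rule deriv_nonneg_imp_le_limit[OF _ _ _ r])
      fix x assume x: "x \<ge> R"
      have x1: "x \<ge> 1" using x R(1) by simp
      show "((\<lambda>r. - (u r / r - \<alpha> / r ^ 3 + D / 5 / r ^ 5)) has_real_derivative
          - (- j x / (x ^ 2 * (x ^ 2 + 1)) - - (real 3 * \<alpha>) / x ^ (3 + 1) + - (real 5 * (D / 5)) / x ^ (5 + 1))) (at x)"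
        using x R(1) by (intro derivative_intros ur_der deriv_divide_power) auto
      have "(l / x ^ 2 - D / x ^ 4) / x ^ 2 \<le> j x / (x ^ 2 + 1) / x ^ 2"
        using j_quot_ge[OF x] by (intro divide_right_mono) auto
      moreover have "(l / x ^ 2 - D / x ^ 4) / x ^ 2 = l / x ^ 4 - D / x ^ 6"
        by (simp add: diff_divide_distrib flip: power_add)
      ultimately show "- (- j x / (x ^ 2 * (x ^ 2 + 1)) - - (real 3 * \<alpha>) / x ^ (3 + 1) + - (real 5 * (D / 5)) / x ^ (5 + 1)) \<ge> 0"
        by (simp add: \<alpha> mult.commute)
    qed (intro tendsto_intros ur_lim tendsto_divide_power_at_top; simp)+
    then have "\<alpha> / r ^ 3 - D / 5 / r ^ 5 \<le> u r / r" by simp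
    then have "(\<alpha> / r ^ 2 - D / 5 / r ^ 4) / r \<le> u r / r"
      by (simp add: diff_divide_distrib eval_nat_numeral mult_ac)
    then have "\<alpha> / r ^ 2 - D / 5 / r ^ 4 \<le> u r" by (rule cancel[OF _ r])
    moreover have "D / 5 / r ^ 4 \<le> D / r ^ 4" using D r R(1) by (intro divide_right_mono) auto
    ultimately show ?thesis by linarith
  qed
  have p_asymp: "\<bar>p r - 2 * \<alpha> / r ^ 3\<bar> \<le> 2 * D / r ^ 5" if r: "r \<ge> R" for r
  proof -
    have r0: "r > 0" using r R(1) by simp
    \<comment> \<open>The definition of \<open>j\<close> solved for \<open>p\<close>, so the
      expansion of \<open>p\<close> follows without differentiating that of \<open>u\<close>. The
      leading coefficient is l - \<alpha> = 2 \<alpha>.\<close>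
    have rp: "r * p r = j r / (r ^ 2 + 1) - u r" unfolding j_def by simp
    have "j r / (r ^ 2 + 1) \<le> l / r ^ 2"
      using j_le[OF r] l r0 by (intro frac_le) auto
    then have "\<bar>r * p r - 2 * \<alpha> / r ^ 2\<bar> \<le> 2 * D / r ^ 4"
      unfolding rp using j_quot_ge[OF r] u_le[OF r] u_ge[OF r] by (simp add: \<alpha>(2) abs_le_iff add_divide_distrib)
    moreover have "r * p r - 2 * \<alpha> / r ^ 2 = r * (p r - 2 * \<alpha> / r ^ 3)"
      using r0 by (simp add: field_simps power2_eq_square power3_eq_cube)
    ultimately have "\<bar>p r - 2 * \<alpha> / r ^ 3\<bar> * r \<le> 2 * D / r ^ 4"
      using r0 by (simp add: abs_mult mult.commute)
    then have "\<bar>p r - 2 * \<alpha> / r ^ 3\<bar> \<le> 2 * D / r ^ 4 / r"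
      using r0 by (simp add: pos_le_divide_eq mult_ac)
    then show ?thesis by (simp add: eval_nat_numeral mult_ac)
  qed
  show ?thesis
    using that[of \<alpha> R D] \<alpha>(1) R(1) D u_le u_ge p_asymp by (auto simp: u_def)
qed

section \<open>Uniqueness\<close>

text \<open>Two solutions will be compared at equal levels, hence at different times, so time and
  energy are bounded through the distance of the level from n pi. Energy is O(r^-4) and this
  distance is bounded below by a multiple of r^-2.\<close>

lemma connects_energy_decay:
  assumes con: "connects n F p" and n: "n \<ge> 1"
  obtains C R where "C > 0" "R \<ge> 1"
    "\<And>r. r \<ge> R \<Longrightarrow> r * (real n * pi - F r) \<le> C"
    "\<And>r. r \<ge> R \<Longrightarrow> energy F p r \<le> C * (real n * pi - F r)\<^sup>2"
proof -
  obtain \<alpha> D R0 where \<alpha>: "\<alpha> > 0" and R0: "R0 \<ge> 1" and D: "D \<ge> 0"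
    and u_le: "\<And>r. r \<ge> R0 \<Longrightarrow> real n * pi - F r \<le> \<alpha> / r ^ 2"
    and u_ge: "\<And>r. r \<ge> R0 \<Longrightarrow> real n * pi - F r \<ge> \<alpha> / r ^ 2 - D / r ^ 4"
    and p_bd: "\<And>r. r \<ge> R0 \<Longrightarrow> \<bar>p r - 2 * \<alpha> / r ^ 3\<bar> \<le> 2 * D / r ^ 5"
    using connects_asymptotics[OF con n] by metis
  \<comment> \<open>Beyond 2 D/\<alpha> the error D r^-4 is at most half of \<alpha> r^-2.\<close>
  define R where "R = max R0 (2 * D / \<alpha>)"
  define B where "B = 2 * \<alpha> + 2 * D"
  have B: "B > 0" using \<alpha> D by (simp add: B_def)
  \<comment> \<open>The summand \<alpha> serves the bound on the time; the other one is the ratio of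
    B^2 r^-4, which bounds the energy, to the square of \<alpha> r^-2 / 2.\<close>
  define C where "C = \<alpha> + 4 * B\<^sup>2 / \<alpha>\<^sup>2"
  show ?thesis
  proof (rule that[of C R])
    show "C > 0" using \<alpha> by (simp add: C_def add_pos_nonneg)
    show "R \<ge> 1" using R0 by (simp add: R_def)
    fix r assume "r \<ge> R"
    then have r: "r \<ge> R0" "r \<ge> 2 * D / \<alpha>" "r \<ge> 1" using R0 by (auto simp: R_def)
    define u where "u = real n * pi - F r"
    have "r * u \<le> r * (\<alpha> / r ^ 2)"
      using u_le[OF r(1)] r(3) unfolding u_def by (intro mult_left_mono) auto
    also have "\<dots> = \<alpha> / r" using r(3) by (simp add: power2_eq_square)
    also have "\<dots> \<le> \<alpha> / 1" using \<alpha> r(3) by (intro divide_left_mono) auto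
    also have "\<dots> \<le> C" by (simp add: C_def)
    finally show "r * (real n * pi - F r) \<le> C" unfolding u_def .
    have "2 * D \<le> \<alpha> * r" using r(2) \<alpha> by (simp add: divide_le_eq mult.commute)
    also have "\<dots> \<le> \<alpha> * r ^ 2" using \<alpha> r(3) by (intro mult_left_mono) (auto simp: power2_eq_square)
    finally have "2 * D / r ^ 4 \<le> \<alpha> * r ^ 2 / r ^ 4" by (intro divide_right_mono) auto
    also have "\<dots> = \<alpha> / r ^ 2" using r(3) by (simp add: divide_simps eval_nat_numeral)
    finally have u_lower: "\<alpha> / 2 / r ^ 2 \<le> u"
      using u_ge[OF r(1)] unfolding u_def by simp
    have "2 * D / r ^ 5 \<le> 2 * D / r ^ 3"
      using D r(3) by (intro divide_left_mono power_increasing) auto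
    then have p_le: "p r \<le> B / r ^ 3"
      using p_bd[OF r(1)] unfolding B_def add_divide_distrib by linarith
    have "energy F p r \<le> (r\<^sup>2 + 1) * (p r)\<^sup>2 / 2" by (simp add: energy_def)
    also have "\<dots> \<le> (2 * r\<^sup>2) * (p r)\<^sup>2 / 2"
      using r(3) one_le_power[of r 2] by (intro divide_right_mono mult_right_mono) auto
    also have "\<dots> \<le> (2 * r\<^sup>2) * (B / r ^ 3)\<^sup>2 / 2"
      using p_le connects_pos(1)[OF con n, of r] by (intro divide_right_mono mult_left_mono power_mono) auto
    also have "\<dots> = 4 * B\<^sup>2 / \<alpha>\<^sup>2 * (\<alpha> / 2 / r ^ 2)\<^sup>2"
    proof -
      define s where "s = r ^ 2"
      have "s \<noteq> 0" "r ^ 3 * r ^ 3 = s * s * s"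
        using r(3) by (auto simp: s_def power_add[symmetric] power_mult[symmetric])
      then show ?thesis
        using \<alpha> unfolding s_def[symmetric] power_divide power2_eq_square[of "r ^ 3"]
        by (simp add: power_mult_distrib power2_eq_square)
    qed
    also have "\<dots> \<le> 4 * B\<^sup>2 / \<alpha>\<^sup>2 * u\<^sup>2"
      using u_lower \<alpha> by (intro mult_left_mono power_mono) auto
    also have "\<dots> \<le> C * u\<^sup>2"
      using \<alpha> by (intro mult_right_mono) (auto simp: C_def)
    finally show "energy F p r \<le> C * (real n * pi - F r)\<^sup>2" unfolding u_def .
  qed
qed

text \<open>With v = n pi - F r, both times are O(1/v) and both energies O(v^2), so the product is
  O(v).\<close>

lemma boundary_term_tendsto_0:
  assumes F: "connects n F p" and G: "connects n G q" and n: "n \<ge> 1"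
    and \<phi>: "\<And>r. G (\<phi> r) = F r"
  shows "((\<lambda>r. (r - \<phi> r) * (energy G q (\<phi> r) - energy F p r)) \<longlongrightarrow> 0) at_top"
proof -
  obtain C R where C: "C > 0" "R \<ge> 1" "\<And>r. r \<ge> R \<Longrightarrow> r * (real n * pi - F r) \<le> C"
      "\<And>r. r \<ge> R \<Longrightarrow> energy F p r \<le> C * (real n * pi - F r)\<^sup>2"
    using connects_energy_decay[OF F n] by metis
  obtain C' R' where C': "C' > 0" "R' \<ge> 1" "\<And>r. r \<ge> R' \<Longrightarrow> r * (real n * pi - G r) \<le> C'"
      "\<And>r. r \<ge> R' \<Longrightarrow> energy G q r \<le> C' * (real n * pi - G r)\<^sup>2"
    using connects_energy_decay[OF G n] by metis
  have F_lim: "(F \<longlongrightarrow> real n * pi) at_top" using F by (simp add: connects_def)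
  have \<phi>_large: "\<forall>\<^sub>F r in at_top. R' \<le> \<phi> r"
    using order_tendstoD(1)[OF F_lim connects_pos(4)[OF G n, of R']]
  proof eventually_elim
    case (elim r)
    then have "R' < \<phi> r"
      using strict_mono_less[OF connects_pos(2)[OF G n]] by (simp flip: \<phi>)
    then show ?case by simp
  qed
  show ?thesis
  proof (rule Lim_null_comparison)
    show "\<forall>\<^sub>F r in at_top. norm ((r - \<phi> r) * (energy G q (\<phi> r) - energy F p r))
        \<le> (C + C')\<^sup>2 * (real n * pi - F r)"
      using eventually_ge_at_top[of R] \<phi>_large
    proof eventually_elim
      case (elim r)
      define v where "v = real n * pi - F r"
      have v: "v > 0" using connects_pos(4)[OF F n] by (simp add: v_def)
      have 1: "\<bar>r - \<phi> r\<bar> \<le> r + \<phi> r" using elim C(2) C'(2) by simp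
      have 2: "\<bar>energy G q (\<phi> r) - energy F p r\<bar> \<le> (C + C') * v\<^sup>2"
        using connects_energy_nonneg[OF F, of r] connects_energy_nonneg[OF G, of "\<phi> r"]
          C(4)[OF elim(1)] C'(4)[OF elim(2)]
        unfolding \<phi> v_def[symmetric] distrib_right by linarith
      have "\<bar>r - \<phi> r\<bar> * \<bar>energy G q (\<phi> r) - energy F p r\<bar> \<le> (r + \<phi> r) * ((C + C') * v\<^sup>2)"
        by (intro mult_mono 1 2) (use elim C(2) C'(2) in auto)
      also have "\<dots> = ((r + \<phi> r) * v) * ((C + C') * v)" by (simp add: power2_eq_square mult_ac)
      also have "\<dots> \<le> (C + C') * ((C + C') * v)"
        using C(3)[OF elim(1)] C'(3)[OF elim(2)] v C(1) C'(1)
        unfolding \<phi> v_def[symmetric] distrib_right[of r] by (intro mult_right_mono) auto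
      finally show ?case by (simp add: abs_mult v_def power2_eq_square mult_ac)
    qed
    have "((\<lambda>r. (C + C')\<^sup>2 * (real n * pi - F r)) \<longlongrightarrow> (C + C')\<^sup>2 * (real n * pi - real n * pi)) at_top"
      by (intro tendsto_intros F_lim)
    then show "((\<lambda>r. (C + C')\<^sup>2 * (real n * pi - F r)) \<longlongrightarrow> 0) at_top" by simp
  qed
qed

text \<open>Parametrised by the level \<open>y = F r\<close>, the action \<open>\<integral> (r\<^sup>2+1) / (2 r') + r' sin\<^sup>2 y dy\<close> is
  a convex functional of \<open>r(y)\<close>. The function \<open>b\<close> below is the boundary term of the resulting
  monotonicity of the Euler-Lagrange operator.\<close>
lemma connects_unique:
  assumes F: "connects n F p" and G: "connects n G q" and n: "n \<ge> 1"
  shows "F r = G r"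
proof -
  define g where "g = inv G"
  have G_mono: "strict_mono G" by (rule connects_pos(2)[OF G n])
  have G_lim: "(G \<longlongrightarrow> 0) at_bot" "(G \<longlongrightarrow> real n * pi) at_top"
    and solF: "solution_pair F p" and solG: "solution_pair G q"
    using F G by (auto simp: connects_def)
  have g_G: "g (G s) = s" for s
    unfolding g_def using strict_mono_imp_inj_on[OF G_mono] by (rule inv_f_f)
  have G_g: "G (g y) = y" if y: "0 < y" "y < real n * pi" for y
  proof -
    obtain a where a: "G a < y"
      using eventually_happens[OF order_tendstoD(2)[OF G_lim(1) y(1)]] by auto
    obtain b where b: "y < G b"
      using eventually_happens[OF order_tendstoD(1)[OF G_lim(2) y(2)]] by auto
    have "G a < G b" using a b by simp
    then have "a \<le> b" using strict_mono_less[OF G_mono] by simp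
    then have "\<exists>s\<ge>a. s \<le> b \<and> G s = y"
      using a b by (intro IVT' solution_pair_continuous(1)[OF solG]) auto
    then obtain s where "G s = y" by blast
    then show ?thesis using g_G by metis
  qed
  have q_pos: "q s > 0" for s by (rule connects_pos(1)[OF G n])
  have p_pos: "p s > 0" for s by (rule connects_pos(1)[OF F n])
  have g_der: "(g has_real_derivative inverse (q (g y))) (at y)" if y: "0 < y" "y < real n * pi" for y
  proof (rule DERIV_inverse_function[OF solution_pairD(1)[OF solG] _ y])
    show "q (g y) \<noteq> 0" using q_pos[of "g y"] by simp
    have "isCont g (G (g y))"
      by (rule isCont_inverse_function[of 1])
        (use g_G DERIV_isCont[OF solution_pairD(1)[OF solG]] in auto)
    then show "isCont g y" by (simp add: G_g[OF y])
  qed (use G_g in auto)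
  define \<phi> where "\<phi> s = g (F s)" for s
  have F_range: "0 < F s" "F s < real n * pi" for s
    using connects_pos[OF F n] by auto
  have \<phi>: "G (\<phi> s) = F s" for s unfolding \<phi>_def by (intro G_g F_range)
  have \<phi>_der: "(\<phi> has_real_derivative inverse (q (\<phi> s)) * p s) (at s)" for s
    unfolding \<phi>_def by (intro DERIV_chain2[OF g_der] F_range solution_pairD(1)[OF solF])
  \<comment> \<open>For this Lagrangian the momentum conjugate to \<open>r\<close> is
    \<open>- energy\<close>, so \<open>b\<close> is the product of the differences of position and
    momentum at equal level. In \<open>b'\<close> the sin^2 terms have cancelled because
    \<open>G (\<phi> s) = F s\<close>; as \<open>p\<close> and \<open>q\<close> are positive, the
    sum of squares left vanishes only for \<open>s = \<phi> s\<close>.\<close>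
  define b where "b s = (s - \<phi> s) * (energy G q (\<phi> s) - energy F p s)" for s
  define b' where "b' s = 1 / 2 * (1 + p s / q (\<phi> s)) *
      ((s * p s - \<phi> s * q (\<phi> s))\<^sup>2 + (p s - q (\<phi> s))\<^sup>2)" for s
  have b_der: "(b has_real_derivative b' s) (at s)" for s
  proof -
    define P Q f where "P = p s" and "Q = q (\<phi> s)" and "f = \<phi> s"
    have Q: "Q \<noteq> 0" using q_pos[of "\<phi> s"] by (simp add: Q_def)
    have "(b has_real_derivative (1 - inverse Q * P) * (energy G q f - energy F p s)
        + (- f * Q\<^sup>2 * (inverse Q * P) - - s * P\<^sup>2) * (s - f)) (at s)"
      unfolding b_def P_def Q_def f_def
      by (intro DERIV_mult DERIV_diff DERIV_ident \<phi>_der energy_deriv solF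
          DERIV_chain2[OF energy_deriv[OF solG] \<phi>_der])
    also have "energy G q f - energy F p s = (f\<^sup>2 + 1) * Q\<^sup>2 / 2 - (s\<^sup>2 + 1) * P\<^sup>2 / 2"
      unfolding energy_def P_def Q_def f_def \<phi> by simp
    also have "(1 - inverse Q * P) * ((f\<^sup>2 + 1) * Q\<^sup>2 / 2 - (s\<^sup>2 + 1) * P\<^sup>2 / 2)
        + (- f * Q\<^sup>2 * (inverse Q * P) - - s * P\<^sup>2) * (s - f)
        = 1 / 2 * (1 + P / Q) * ((s * P - f * Q)\<^sup>2 + (P - Q)\<^sup>2)"
      using Q by (simp add: field_simps power2_eq_square)
    finally show ?thesis by (simp add: b'_def P_def Q_def f_def)
  qed
  have b'_nonneg: "b' s \<ge> 0" for s
    unfolding b'_def using p_pos[of s] q_pos[of "\<phi> s"] by (intro mult_nonneg_nonneg add_nonneg_nonneg) auto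
  \<comment> \<open>\<open>b\<close> is nondecreasing and tends to 0 at both ends, so it and its
    derivative vanish identically.\<close>
  have b_le: "b s \<le> 0" for s
  proof (rule deriv_nonneg_imp_le_limit[of s b b'])
    show "(b \<longlongrightarrow> 0) at_top"
      unfolding b_def by (rule boundary_term_tendsto_0[where \<phi> = \<phi>, OF F G n \<phi>])
  qed (use b_der b'_nonneg in auto)
  have b_ge: "b s \<ge> 0" for s
  proof -
    \<comment> \<open>The reflected solutions have equal levels at the times \<open>s\<close> and
      \<open>- \<phi> (- s)\<close>, which moves the limit at minus infinity to plus
      infinity.\<close>
    have "((\<lambda>s. (s - - \<phi> (- s)) * (energy (\<lambda>r. real n * pi - G (- r)) (\<lambda>r. q (- r)) (- \<phi> (- s))
        - energy (\<lambda>r. real n * pi - F (- r)) (\<lambda>r. p (- r)) s)) \<longlongrightarrow> 0) at_top"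
      by (rule boundary_term_tendsto_0[OF connects_reflect[OF F] connects_reflect[OF G] n]) (simp add: \<phi>)
    moreover have "(s - - \<phi> (- s)) * (energy (\<lambda>r. real n * pi - G (- r)) (\<lambda>r. q (- r)) (- \<phi> (- s))
        - energy (\<lambda>r. real n * pi - F (- r)) (\<lambda>r. p (- r)) s) = - b (- s)" for s
      unfolding energy_reflect b_def by (simp add: algebra_simps)
    ultimately have lim: "((\<lambda>s. - b (- s)) \<longlongrightarrow> 0) at_top" by simp
    have "- b (- (- s)) \<le> 0"
    proof (rule deriv_nonneg_imp_le_limit[OF _ _ lim order_refl])
      fix x
      show "((\<lambda>s. - b (- s)) has_real_derivative b' (- x)) (at x)"
        using DERIV_minus[OF iffD1[OF DERIV_mirror b_der[of "- x"]]] by simp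
    qed (rule b'_nonneg)
    then show ?thesis by simp
  qed
  have "b = (\<lambda>_. 0)" using b_le b_ge by (intro ext antisym)
  then have "b' r = 0" using DERIV_unique[OF b_der[of r]] by simp
  moreover have "1 + p r / q (\<phi> r) > 0" using p_pos[of r] q_pos[of "\<phi> r"] by (simp add: add_pos_pos)
  moreover have "x = 0" if "1 / 2 * c * x = 0" "c > 0" for c x :: real
    using that by simp
  ultimately have "(r * p r - \<phi> r * q (\<phi> r))\<^sup>2 + (p r - q (\<phi> r))\<^sup>2 = 0"
    unfolding b'_def by blast
  then have "r * p r - \<phi> r * q (\<phi> r) = 0 \<and> p r - q (\<phi> r) = 0"
    by (simp only: sum_power2_eq_zero_iff)
  then have "r * p r = \<phi> r * q (\<phi> r)" "p r = q (\<phi> r)" by linarith+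
  then have "r * p r = \<phi> r * p r" by metis
  then have "r = \<phi> r" using p_pos[of r] by (metis less_irrefl mult_right_cancel)
  then show ?thesis using \<phi>[of r] by simp
qed

section \<open>Smoothness\<close>

text \<open>An algebra containing \<open>F\<close> and closed under differentiation: by the
  equation, the derivative of each generator is a polynomial in the generators. All derivatives of
  \<open>F\<close> therefore exist.\<close>

inductive ode_algebra :: "(real \<Rightarrow> real) \<Rightarrow> (real \<Rightarrow> real) \<Rightarrow> (real \<Rightarrow> real) \<Rightarrow> bool"
  for F p :: "real \<Rightarrow> real" where
  const: "ode_algebra F p (\<lambda>_. c)"
| ident: "ode_algebra F p (\<lambda>r. r)"
| recip: "ode_algebra F p (\<lambda>r. 1 / (r\<^sup>2 + 1))"
| F: "ode_algebra F p F"
| p: "ode_algebra F p p"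
| sin: "ode_algebra F p (\<lambda>r. sin (2 * F r))"
| cos: "ode_algebra F p (\<lambda>r. cos (2 * F r))"
| add: "ode_algebra F p f \<Longrightarrow> ode_algebra F p g \<Longrightarrow> ode_algebra F p (\<lambda>r. f r + g r)"
| mult: "ode_algebra F p f \<Longrightarrow> ode_algebra F p g \<Longrightarrow> ode_algebra F p (\<lambda>r. f r * g r)"

lemma ode_algebra_deriv:
  assumes sol: "solution_pair F p" and "ode_algebra F p f"
  shows "\<exists>g. ode_algebra F p g \<and> (\<forall>x. (f has_real_derivative g x) (at x))"
  using assms(2)
proof induction
  case (const c)
  show ?case by (intro exI[of _ "\<lambda>_. 0"]) (auto intro: ode_algebra.const)
next
  case ident
  show ?case by (intro exI[of _ "\<lambda>_. 1"]) (auto intro: ode_algebra.const)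
next
  case recip
  have "((\<lambda>r. 1 / (r\<^sup>2 + 1)) has_real_derivative (- 2) * x * (1 / (x\<^sup>2 + 1) * (1 / (x\<^sup>2 + 1)))) (at x)"
    for x :: real
    by (auto intro!: derivative_eq_intros)
  then show ?case
    by (intro exI[of _ "\<lambda>x. (- 2) * x * (1 / (x\<^sup>2 + 1) * (1 / (x\<^sup>2 + 1)))"] conjI ode_algebra.intros) auto
next
  case F
  then show ?case using solution_pairD(1)[OF sol] ode_algebra.p by blast
next
  case p
  have "(p has_real_derivative (sin (2 * F x) + (- 2) * x * p x) * (1 / (x\<^sup>2 + 1))) (at x)" for x
    using solution_pairD(2)[OF sol, of x] by simp
  then show ?case
    by (intro exI[of _ "\<lambda>x. (sin (2 * F x) + (- 2) * x * p x) * (1 / (x\<^sup>2 + 1))"] conjI ode_algebra.intros) auto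
next
  case sin
  have "((\<lambda>r. sin (2 * F r)) has_real_derivative 2 * p x * cos (2 * F x)) (at x)" for x
    by (auto intro!: derivative_eq_intros solution_pairD[OF sol])
  then show ?case
    by (intro exI[of _ "\<lambda>x. 2 * p x * cos (2 * F x)"] conjI ode_algebra.intros) auto
next
  case cos
  have "((\<lambda>r. cos (2 * F r)) has_real_derivative (- 2) * p x * sin (2 * F x)) (at x)" for x
    by (auto intro!: derivative_eq_intros solution_pairD[OF sol])
  then show ?case
    by (intro exI[of _ "\<lambda>x. (- 2) * p x * sin (2 * F x)"] conjI ode_algebra.intros) auto
next
  case (add f g)
  then obtain f' g' where "ode_algebra F p f'" "\<And>x. (f has_real_derivative f' x) (at x)"
    "ode_algebra F p g'" "\<And>x. (g has_real_derivative g' x) (at x)" by blast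
  then show ?case
    by (intro exI[of _ "\<lambda>x. f' x + g' x"] conjI ode_algebra.intros allI DERIV_add)
next
  case (mult f g)
  then obtain f' g' where "ode_algebra F p f'" "\<And>x. (f has_real_derivative f' x) (at x)"
    "ode_algebra F p g'" "\<And>x. (g has_real_derivative g' x) (at x)" by blast
  then show ?case using mult.hyps
    by (intro exI[of _ "\<lambda>x. f' x * g x + g' x * f x"] conjI ode_algebra.intros allI DERIV_mult)
qed

lemma solution_pair_smooth:
  assumes sol: "solution_pair F p"
  shows "smooth F"
proof -
  have "ode_algebra F p ((deriv ^^ k) F)" for k
  proof (induction k)
    case 0
    show ?case by (simp add: ode_algebra.F)
  next
    case (Suc k)
    then obtain g where "ode_algebra F p g" "\<And>x. ((deriv ^^ k) F has_real_derivative g x) (at x)"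
      using ode_algebra_deriv[OF sol] by blast
    moreover from this have "(deriv ^^ Suc k) F = g" by (auto intro: DERIV_imp_deriv)
    ultimately show ?case by simp
  qed
  then show ?thesis
    unfolding smooth_def using ode_algebra_deriv[OF sol] by (meson real_differentiable_def)
qed

lemma connects_imp_smooth_solution:
  assumes "connects n F p"
  shows "smooth_solution n F"
proof -
  have sol: "solution_pair F p" using assms by (simp add: connects_def)
  have d: "deriv F = p" using solution_pairD(1)[OF sol] by (auto intro: DERIV_imp_deriv)
  have "deriv p r = (sin (2 * F r) - 2 * r * p r) / (r\<^sup>2 + 1)" for r
    by (rule DERIV_imp_deriv[OF solution_pairD(2)[OF sol]])
  then have "solves_ode F"
    unfolding solves_ode_def d by (simp add: diff_divide_distrib)
  then show ?thesis
    using assms solution_pair_smooth[OF sol] by (simp add: smooth_solution_def connects_def)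
qed

lemma smooth_solution_imp_connects:
  assumes "smooth_solution n F"
  shows "connects n F (deriv F)"
proof -
  have sm: "(deriv ^^ k) F differentiable (at x)" for k x
    using assms by (simp add: smooth_solution_def smooth_def)
  have "deriv (deriv F) r = (sin (2 * F r) - 2 * r * deriv F r) / (r\<^sup>2 + 1)" for r
  proof -
    have "deriv (deriv F) r + 2 * r / (r\<^sup>2 + 1) * deriv F r - sin (2 * F r) / (r\<^sup>2 + 1) = 0"
      using assms by (simp add: smooth_solution_def solves_ode_def)
    then show ?thesis by (simp add: diff_divide_distrib)
  qed
  moreover have "(F has_real_derivative deriv F r) (at r)"
    "(deriv F has_real_derivative deriv (deriv F) r) (at r)" for r
    using sm[of 0 r] sm[of 1 r] by (simp_all add: DERIV_deriv_iff_real_differentiable)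
  ultimately have "solution_pair F (deriv F)"
    unfolding solution_pair_def by metis
  then show ?thesis using assms by (simp add: connects_def smooth_solution_def)
qed

section \<open>Derivatives of the error term\<close>

text \<open>\<open>symbol \<alpha> E E' m f\<close>: \<open>f\<close> is a sum of products of functions of known decay at infinity, of total
  order \<open>r\<^sup>m\<close>. If \<open>v = \<alpha> r\<^sup>-\<^sup>2 + E\<close> solves the equation then each derivative stays in this
  class and lowers the order by one.\<close>
inductive symbol :: "real \<Rightarrow> (real \<Rightarrow> real) \<Rightarrow> (real \<Rightarrow> real) \<Rightarrow> int \<Rightarrow> (real \<Rightarrow> real) \<Rightarrow> bool"
  for \<alpha> :: real and E E' :: "real \<Rightarrow> real" where
  const: "symbol \<alpha> E E' 0 (\<lambda>_. c)"
| powi: "symbol \<alpha> E E' k (\<lambda>r. r powi k)"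
| recip: "symbol \<alpha> E E' (- 2) (\<lambda>r. 1 / (r\<^sup>2 + 1))"
| err: "symbol \<alpha> E E' (- 4) E"
| err': "symbol \<alpha> E E' (- 5) E'"
| sin: "symbol \<alpha> E E' (- 6) (\<lambda>r. sin (2 * (\<alpha> * r powi (- 2) + E r)) - 2 * (\<alpha> * r powi (- 2) + E r))"
| cos: "symbol \<alpha> E E' (- 4) (\<lambda>r. cos (2 * (\<alpha> * r powi (- 2) + E r)) - 1)"
| add: "symbol \<alpha> E E' k f \<Longrightarrow> symbol \<alpha> E E' l g \<Longrightarrow> k \<le> m \<Longrightarrow> l \<le> m \<Longrightarrow> symbol \<alpha> E E' m (\<lambda>r. f r + g r)"
| mult: "symbol \<alpha> E E' k f \<Longrightarrow> symbol \<alpha> E E' l g \<Longrightarrow> m = k + l \<Longrightarrow> symbol \<alpha> E E' m (\<lambda>r. f r * g r)"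

lemma symbol_cmult: "symbol \<alpha> E E' m f \<Longrightarrow> symbol \<alpha> E E' m (\<lambda>r. c * f r)"
  by (rule symbol.mult[OF symbol.const]) auto

lemma deriv_powi:
  fixes x :: real
  assumes "x \<noteq> 0"
  shows "((\<lambda>r. r powi k) has_real_derivative of_int k * x powi (k - 1)) (at x)"
  using assms by (auto intro!: derivative_eq_intros)

text \<open>The hypothesis on \<open>E'\<close> is the equation for v = \<alpha> x^-2 + E, arranged
  so that the terms of order -2 have cancelled; they do because x^-2 solves x^2 v'' + 2 x v' = 2 v.
  Every term left in the numerator has order at most -4, so division by x^2 + 1 gives the order -6
  required of the derivative of \<open>E'\<close>.\<close>

lemma symbol_deriv:
  assumes E: "\<And>x. x \<noteq> 0 \<Longrightarrow> (E has_real_derivative E' x) (at x)"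
    and E': "\<And>x. x \<noteq> 0 \<Longrightarrow> (E' has_real_derivative
      (sin (2 * (\<alpha> * x powi (- 2) + E x)) - 2 * (\<alpha> * x powi (- 2) + E x) + 2 * E x - 2 * x * E' x
        - 6 * \<alpha> * x powi (- 4)) / (x\<^sup>2 + 1)) (at x)"
    and "symbol \<alpha> E E' m f"
  shows "\<exists>g. symbol \<alpha> E E' (m - 1) g \<and> (\<forall>x. x \<noteq> 0 \<longrightarrow> (f has_real_derivative g x) (at x))"
  using assms(3)
proof induction
  case (const c)
  \<comment> \<open>The zero function is written as a product to be assigned order -1;
    \<open>symbol.const\<close> gives only order 0.\<close>
  have "symbol \<alpha> E E' (0 - 1) (\<lambda>r. 0 * r powi (- 1))"
    by (intro symbol_cmult) (use symbol.powi[of \<alpha> E E' "- 1"] in simp)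
  then show ?case by (intro exI[of _ "\<lambda>r. 0 * r powi (- 1)"]) auto
next
  case (powi k)
  have "symbol \<alpha> E E' (k - 1) (\<lambda>r. of_int k * r powi (k - 1))"
    by (intro symbol_cmult symbol.powi)
  then show ?case using deriv_powi by blast
next
  case recip
  have "symbol \<alpha> E E' (- 2 - 1) (\<lambda>x. (- 2) * (x powi 1 * (1 / (x\<^sup>2 + 1) * (1 / (x\<^sup>2 + 1)))))"
    by (intro symbol_cmult symbol.mult[OF symbol.powi symbol.mult[OF symbol.recip symbol.recip]]) auto
  moreover have "((\<lambda>r. 1 / (r\<^sup>2 + 1)) has_real_derivative
      (- 2) * (x powi 1 * (1 / (x\<^sup>2 + 1) * (1 / (x\<^sup>2 + 1))))) (at x)" for x :: real
    by (auto intro!: derivative_eq_intros)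
  ultimately show ?case by blast
next
  case err
  then show ?case using E symbol.err'[of \<alpha> E E'] by (intro exI[of _ E']) auto
next
  case err'
  let ?N = "\<lambda>x. sin (2 * (\<alpha> * x powi (- 2) + E x)) - 2 * (\<alpha> * x powi (- 2) + E x)"
  let ?g = "\<lambda>x. ((?N x + 2 * E x) + ((- 2) * (x powi 1 * E' x) + (- 6 * \<alpha>) * x powi (- 4))) * (1 / (x\<^sup>2 + 1))"
  have "symbol \<alpha> E E' (- 4) (\<lambda>x. ?N x + 2 * E x)"
    by (rule symbol.add[OF symbol.sin symbol_cmult[OF symbol.err]]) auto
  moreover have "symbol \<alpha> E E' (- 4) (\<lambda>x. (- 2) * (x powi 1 * E' x) + (- 6 * \<alpha>) * x powi (- 4))"
    by (rule symbol.add[OF symbol_cmult[OF symbol.mult[OF symbol.powi symbol.err' refl]]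
          symbol_cmult[OF symbol.powi]]) auto
  ultimately have "symbol \<alpha> E E' (- 4) (\<lambda>x. (?N x + 2 * E x) + ((- 2) * (x powi 1 * E' x) + (- 6 * \<alpha>) * x powi (- 4)))"
    by (rule symbol.add) auto
  then have "symbol \<alpha> E E' (- 5 - 1) ?g"
    by (rule symbol.mult[OF _ symbol.recip]) auto
  moreover have "(E' has_real_derivative ?g x) (at x)" if "x \<noteq> 0" for x
    using E'[OF that]
    by (simp only: times_divide_eq_right mult.right_neutral power_int_1_right) (simp add: algebra_simps)
  ultimately show ?case by blast
next
  case sin
  let ?w = "\<lambda>x. (- 2 * \<alpha>) * x powi (- 3) + E' x"
  let ?g = "\<lambda>x. 2 * (?w x * (cos (2 * (\<alpha> * x powi (- 2) + E x)) - 1))"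
  have "symbol \<alpha> E E' (- 3) ?w"
    by (rule symbol.add[OF symbol_cmult[OF symbol.powi] symbol.err']) auto
  then have "symbol \<alpha> E E' (- 6 - 1) ?g"
    by (intro symbol_cmult symbol.mult[OF _ symbol.cos]) auto
  moreover have "((\<lambda>r. sin (2 * (\<alpha> * r powi (- 2) + E r)) - 2 * (\<alpha> * r powi (- 2) + E r))
      has_real_derivative ?g x) (at x)" if "x \<noteq> 0" for x
    using that deriv_powi[OF that, of "- 2"]
    by (auto intro!: derivative_eq_intros E simp: algebra_simps)
  ultimately show ?case by blast
next
  case cos
  let ?N = "\<lambda>x. sin (2 * (\<alpha> * x powi (- 2) + E x)) - 2 * (\<alpha> * x powi (- 2) + E x)"
  let ?w = "\<lambda>x. (- 2 * \<alpha>) * x powi (- 3) + E' x"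
  \<comment> \<open>The sine itself, of order only -2, recovered as the cubic remainder plus its
    argument.\<close>
  let ?s = "\<lambda>x. ?N x + ((2 * \<alpha>) * x powi (- 2) + 2 * E x)"
  let ?g = "\<lambda>x. (- 2) * (?w x * ?s x)"
  have "symbol \<alpha> E E' (- 3) ?w"
    by (rule symbol.add[OF symbol_cmult[OF symbol.powi] symbol.err']) auto
  moreover have "symbol \<alpha> E E' (- 2) ?s"
    by (rule symbol.add[OF symbol.sin symbol.add[OF symbol_cmult[OF symbol.powi] symbol_cmult[OF symbol.err]]]) auto
  ultimately have "symbol \<alpha> E E' (- 4 - 1) ?g"
    by (intro symbol_cmult symbol.mult) auto
  moreover have "((\<lambda>r. cos (2 * (\<alpha> * r powi (- 2) + E r)) - 1) has_real_derivative ?g x) (at x)"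
    if "x \<noteq> 0" for x
    using that deriv_powi[OF that, of "- 2"]
    by (auto intro!: derivative_eq_intros E simp: algebra_simps)
  ultimately show ?case by blast
next
  case (add k f l g m)
  then obtain f' g' where "symbol \<alpha> E E' (k - 1) f'" "symbol \<alpha> E E' (l - 1) g'"
    and d: "\<And>x. x \<noteq> 0 \<Longrightarrow> (f has_real_derivative f' x) (at x)"
      "\<And>x. x \<noteq> 0 \<Longrightarrow> (g has_real_derivative g' x) (at x)" by blast
  then have "symbol \<alpha> E E' (m - 1) (\<lambda>x. f' x + g' x)"
    using add.hyps by (intro symbol.add[of _ _ _ "k - 1" f' "l - 1" g']) auto
  then show ?case using d by (intro exI[of _ "\<lambda>x. f' x + g' x"]) (auto intro: DERIV_add)
next
  case (mult k f l g m)
  then obtain f' g' where f'g': "symbol \<alpha> E E' (k - 1) f'" "symbol \<alpha> E E' (l - 1) g'"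
    and d: "\<And>x. x \<noteq> 0 \<Longrightarrow> (f has_real_derivative f' x) (at x)"
      "\<And>x. x \<noteq> 0 \<Longrightarrow> (g has_real_derivative g' x) (at x)" by blast
  have "symbol \<alpha> E E' (m - 1) (\<lambda>x. f' x * g x + g' x * f x)"
    by (rule symbol.add[OF symbol.mult[OF f'g'(1) mult.hyps(2) refl] symbol.mult[OF f'g'(2) mult.hyps(1) refl]])
      (use mult.hyps in auto)
  then show ?case using d by (intro exI[of _ "\<lambda>x. f' x * g x + g' x * f x"]) (auto intro: DERIV_mult)
qed

text \<open>Agreement away from 0 holds on an open set, so it passes from one derivative to the
  next.\<close>

lemma symbol_higher_deriv:
  assumes E: "\<And>x. x \<noteq> 0 \<Longrightarrow> (E has_real_derivative E' x) (at x)"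
    and E': "\<And>x. x \<noteq> 0 \<Longrightarrow> (E' has_real_derivative
      (sin (2 * (\<alpha> * x powi (- 2) + E x)) - 2 * (\<alpha> * x powi (- 2) + E x) + 2 * E x - 2 * x * E' x
        - 6 * \<alpha> * x powi (- 4)) / (x\<^sup>2 + 1)) (at x)"
    and f: "symbol \<alpha> E E' m f"
  shows "\<exists>g. symbol \<alpha> E E' (m - int k) g \<and> (\<forall>x. x \<noteq> 0 \<longrightarrow> (deriv ^^ k) f x = g x)"
proof (induction k)
  case 0
  show ?case using f by auto
next
  case (Suc k)
  then obtain g where g: "symbol \<alpha> E E' (m - int k) g" "\<And>x. x \<noteq> 0 \<Longrightarrow> (deriv ^^ k) f x = g x" by blast
  obtain h where h: "symbol \<alpha> E E' (m - int k - 1) h" "\<And>x. x \<noteq> 0 \<Longrightarrow> (g has_real_derivative h x) (at x)"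
    using symbol_deriv[OF E E' g(1)] by blast
  have "(deriv ^^ Suc k) f x = h x" if "x \<noteq> 0" for x
  proof -
    have "((deriv ^^ k) f has_real_derivative h x) (at x)"
      by (rule has_field_derivative_transform_within_open[OF h(2)[OF that], of "- {0}"])
        (use that g(2) in auto)
    then show ?thesis by (simp add: DERIV_imp_deriv)
  qed
  moreover have "m - int k - 1 = m - int (Suc k)" by simp
  ultimately show ?case using h(1) by metis
qed

lemma abs_cos_minus_1_le: "\<bar>cos x - 1\<bar> \<le> x\<^sup>2" for x :: real
proof -
  have "1 - cos x = 2 * (sin (x / 2))\<^sup>2" using cos_double_sin[of "x / 2"] by simp
  also have "(sin (x / 2))\<^sup>2 \<le> (x / 2)\<^sup>2"
    by (metis abs_sin_x_le_abs_x abs_ge_zero power2_abs power_mono)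
  also have "2 * (x / 2)\<^sup>2 \<le> x\<^sup>2" by (simp add: power_divide)
  finally have "1 - cos x \<le> x\<^sup>2" by simp
  then show ?thesis using cos_le_one[of x] by linarith
qed

lemma abs_sin_minus_self_le: "\<bar>sin x - x\<bar> \<le> \<bar>x ^ 3\<bar>" for x :: real
proof -
  have "\<bar>sin x - x\<bar> \<le> \<bar>x\<bar> ^ 3 / 6"
    using Maclaurin_sin_bound[of x 3] by (simp add: numeral_3_eq_3 sin_coeff_def fact_numeral)
  also have "\<dots> \<le> \<bar>x\<bar> ^ 3" by simp
  finally show ?thesis by (simp add: power_abs)
qed

text \<open>The orders of the trigonometric generators come from v = O(r^-2): sin v - v is O(v^3),
  hence of order -6, and cos v - 1 is O(v^2), hence of order -4.\<close>

lemma symbol_bigo: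
  assumes G: "\<forall>\<^sub>F r in G. \<bar>r\<bar> \<ge> 1"
    and E: "E \<in> O[G](\<lambda>r. \<bar>r\<bar> powi (- 4))" and E': "E' \<in> O[G](\<lambda>r. \<bar>r\<bar> powi (- 5))"
    and "symbol \<alpha> E E' m f"
  shows "f \<in> O[G](\<lambda>r. \<bar>r\<bar> powi m)"
proof -
  have mono: "(\<lambda>r. \<bar>r\<bar> powi k) \<in> O[G](\<lambda>r. \<bar>r\<bar> powi m)" if "k \<le> m" for k m
    using that by (intro bigoI[of _ 1] eventually_mono[OF G]) (simp add: power_int_increasing)
  have powi_bigo: "(\<lambda>r. r powi k) \<in> O[G](\<lambda>r. \<bar>r\<bar> powi k)" for k
    by (intro bigoI[of _ 1] always_eventually) (simp add: power_int_abs)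
  define v where "v r = 2 * (\<alpha> * r powi (- 2) + E r)" for r
  have "(\<lambda>r. \<alpha> * r powi (- 2) + E r) \<in> O[G](\<lambda>r. \<bar>r\<bar> powi (- 2))"
  proof (rule sum_in_bigo)
    show "(\<lambda>r. \<alpha> * r powi (- 2)) \<in> O[G](\<lambda>r. \<bar>r\<bar> powi (- 2))"
      using powi_bigo[of "- 2"] by (cases "\<alpha> = 0") auto
    show "E \<in> O[G](\<lambda>r. \<bar>r\<bar> powi (- 2))"
      by (rule landau_o.big_trans[OF E mono]) simp
  qed
  then have v: "v \<in> O[G](\<lambda>r. \<bar>r\<bar> powi (- 2))"
    unfolding v_def by (simp del: distrib_left_numeral)
  show ?thesis
    using assms(4)
  proof induction
    case (const c)
    show ?case by simp
  next
    case (powi k)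
    show ?case by (rule powi_bigo)
  next
    case recip
    show ?case
    proof (intro bigoI[of _ 1] eventually_mono[OF G])
      fix r :: real assume "\<bar>r\<bar> \<ge> 1"
      then have "r \<noteq> 0" by auto
      then have "1 / (r\<^sup>2 + 1) \<le> 1 / r\<^sup>2" by (intro divide_left_mono mult_pos_pos) auto
      then show "norm (1 / (r\<^sup>2 + 1)) \<le> 1 * norm (\<bar>r\<bar> powi - 2)"
        by (simp add: power_int_minus inverse_eq_divide)
    qed
  next
    case err
    show ?case by (rule E)
  next
    case err'
    show ?case by (rule E')
  next
    case sin
    have "(\<lambda>r. sin (v r) - v r) \<in> O[G](\<lambda>r. v r ^ 3)"
      by (intro bigoI[of _ 1] always_eventually) (simp add: abs_sin_minus_self_le)
    also have "(\<lambda>r. v r ^ 3) \<in> O[G](\<lambda>r. (\<bar>r\<bar> powi (- 2)) ^ 3)"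
      by (rule landau_o.big_power[OF v])
    also have "(\<lambda>r::real. (\<bar>r\<bar> powi (- 2)) ^ 3) = (\<lambda>r. \<bar>r\<bar> powi (- 6))"
      using power_int_mult[of "\<bar>r\<bar>" "- 2" 3 for r :: real] by simp
    finally show ?case unfolding v_def .
  next
    case cos
    have "(\<lambda>r. cos (v r) - 1) \<in> O[G](\<lambda>r. (v r)\<^sup>2)"
      by (intro bigoI[of _ 1] always_eventually)
        (simp only: real_norm_def abs_power2 mult_1_left abs_cos_minus_1_le simp_thms)
    also have "(\<lambda>r. (v r)\<^sup>2) \<in> O[G](\<lambda>r. (\<bar>r\<bar> powi (- 2))\<^sup>2)"
      by (rule landau_o.big_power[OF v])
    also have "(\<lambda>r::real. (\<bar>r\<bar> powi (- 2))\<^sup>2) = (\<lambda>r. \<bar>r\<bar> powi (- 4))"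
      using power_int_mult[of "\<bar>r\<bar>" "- 2" 2 for r :: real] by simp
    finally show ?case unfolding v_def .
  next
    case (add k f l g m)
    show ?case
      by (intro sum_in_bigo landau_o.big_trans[OF add.IH(1) mono] landau_o.big_trans[OF add.IH(2) mono] add.hyps)
  next
    case (mult k f l g m)
    have "(\<lambda>r. f r * g r) \<in> O[G](\<lambda>r. \<bar>r\<bar> powi k * \<bar>r\<bar> powi l)"
      by (rule landau_o.big.mult[OF mult.IH])
    also have "(\<lambda>r. \<bar>r\<bar> powi k * \<bar>r\<bar> powi l) \<in> O[G](\<lambda>r. \<bar>r\<bar> powi m)"
      by (intro bigoI[of _ 1] eventually_mono[OF G]) (auto simp: power_int_add mult.hyps)
    finally show ?case .
  qed
qed

text \<open>Bounds on the error and its first derivative suffice, since every further derivative is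
  a symbol built from these two. The sign of \<alpha> is free, so both ends are covered.\<close>

lemma solution_pair_expansion:
  assumes sol: "solution_pair v w" and G: "\<forall>\<^sub>F r in G. \<bar>r\<bar> \<ge> 1"
    and v: "(\<lambda>r. v r - \<alpha> * r powi (- 2)) \<in> O[G](\<lambda>r. \<bar>r\<bar> powi (- 4))"
    and w: "(\<lambda>r. w r + 2 * \<alpha> * r powi (- 3)) \<in> O[G](\<lambda>r. \<bar>r\<bar> powi (- 5))"
  shows "bigo_deriv 4 G (\<lambda>r. v r - \<alpha> * r powi (- 2))"
  unfolding bigo_deriv_def
proof
  fix k
  define E where "E r = v r - \<alpha> * r powi (- 2)" for r
  define E' where "E' r = w r + 2 * \<alpha> * r powi (- 3)" for r
  have E: "(E has_real_derivative E' x) (at x)" if "x \<noteq> 0" for x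
    unfolding E_def E'_def using that
    by (auto intro!: derivative_eq_intros solution_pairD[OF sol])
  have E': "(E' has_real_derivative
      (sin (2 * (\<alpha> * x powi (- 2) + E x)) - 2 * (\<alpha> * x powi (- 2) + E x) + 2 * E x - 2 * x * E' x
        - 6 * \<alpha> * x powi (- 4)) / (x\<^sup>2 + 1)) (at x)" if x: "x \<noteq> 0" for x
  proof -
    have "(E' has_real_derivative (sin (2 * v x) - 2 * x * w x) / (x\<^sup>2 + 1) + 2 * \<alpha> * (of_int (- 3) * x powi (- 3 - 1))) (at x)"
      unfolding E'_def by (intro DERIV_add DERIV_cmult solution_pairD[OF sol] deriv_powi x)
    also have "(sin (2 * v x) - 2 * x * w x) / (x\<^sup>2 + 1) + 2 * \<alpha> * (of_int (- 3) * x powi (- 3 - 1))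
      = (sin (2 * (\<alpha> * x powi (- 2) + E x)) - 2 * (\<alpha> * x powi (- 2) + E x) + 2 * E x - 2 * x * E' x
        - 6 * \<alpha> * x powi (- 4)) / (x\<^sup>2 + 1)"
    proof -
      have 3: "x * x powi (- 3) = x powi (- 2)" and 4: "x\<^sup>2 * x powi (- 4) = x powi (- 2)"
        using x by (simp_all add: power_int_minus field_simps eval_nat_numeral)
      have "2 * \<alpha> * (of_int (- 3) * x powi (- 3 - 1)) = (- 6 * \<alpha> * x powi (- 4)) * (x\<^sup>2 + 1) / (x\<^sup>2 + 1)"
        by simp
      also have "(- 6 * \<alpha> * x powi (- 4)) * (x\<^sup>2 + 1) = - 6 * \<alpha> * x powi (- 2) - 6 * \<alpha> * x powi (- 4)"
        unfolding 4[symmetric] by (simp add: algebra_simps)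
      finally have 5: "2 * \<alpha> * (of_int (- 3) * x powi (- 3 - 1)) =
          (- 6 * \<alpha> * x powi (- 2) - 6 * \<alpha> * x powi (- 4)) / (x\<^sup>2 + 1)" .
      have 6: "\<alpha> * x powi (- 2) + E x = v x" by (simp add: E_def)
      have 7: "2 * x * E' x = 2 * x * w x + 4 * \<alpha> * x powi (- 2)"
        unfolding E'_def 3[symmetric] by (simp add: algebra_simps)
      show ?thesis
        unfolding 5 6 7 add_divide_distrib[symmetric] by (simp add: E_def algebra_simps)
    qed
    finally show ?thesis .
  qed
  obtain g where g: "symbol \<alpha> E E' (- 4 - int k) g" "\<And>x. x \<noteq> 0 \<Longrightarrow> (deriv ^^ k) E x = g x"
    using symbol_higher_deriv[where E = E and E' = E', OF E E' symbol.err, of k] by blast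
  have "g \<in> O[G](\<lambda>r. \<bar>r\<bar> powi (- 4 - int k))"
    by (rule symbol_bigo[OF G _ _ g(1)]) (use v w in \<open>simp_all add: E_def [abs_def] E'_def [abs_def]\<close>)
  moreover have "\<forall>\<^sub>F r in G. (deriv ^^ k) E r = g r"
    using G by eventually_elim (use g(2) in auto)
  ultimately have "(deriv ^^ k) E \<in> O[G](\<lambda>r. \<bar>r\<bar> powi (- 4 - int k))"
    using landau_o.big.in_cong by blast
  then show "(deriv ^^ k) (\<lambda>r. v r - \<alpha> * r powi (- 2)) \<in> O[G](\<lambda>r. \<bar>r\<bar> powi (- int 4 - int k))"
    by (simp add: E_def [abs_def])
qed

lemma solution_pair_shift:
  assumes "solution_pair F p"
  shows "solution_pair (\<lambda>r. F r - real n * pi) p"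
proof -
  have "sin (2 * (F r - real n * pi)) = sin (2 * F r)" for r
    using sin_diff[of "2 * F r" "real (2 * n) * pi"] unfolding sin_npi cos_npi
    by (simp add: algebra_simps)
  then show ?thesis
    using assms unfolding solution_pair_def by (auto intro!: derivative_eq_intros)
qed

text \<open>The symmetry carries the estimates from plus to minus infinity, so one \<alpha> serves
  both ends. At plus infinity the symbol calculus is applied to \<open>F r - n * pi\<close>, with
  coefficient \<open>- \<alpha>\<close>.\<close>

lemma connects_expansion:
  assumes con: "connects n F p" and n: "n \<ge> 1" and sym: "\<And>r. F r + F (- r) = real n * pi"
    and sym_p: "\<And>r. p (- r) = p r"
  obtains \<alpha> where "\<alpha> > 0"
    "bigo_deriv 4 at_top (\<lambda>r. F r - (real n * pi - \<alpha> * r powi (- 2)))"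
    "bigo_deriv 4 at_bot (\<lambda>r. F r - \<alpha> * r powi (- 2))"
proof -
  obtain \<alpha> D R where \<alpha>: "\<alpha> > 0" and R: "R \<ge> 1" and D: "D \<ge> 0"
    and u_le: "\<And>r. r \<ge> R \<Longrightarrow> real n * pi - F r \<le> \<alpha> / r ^ 2"
    and u_ge: "\<And>r. r \<ge> R \<Longrightarrow> real n * pi - F r \<ge> \<alpha> / r ^ 2 - D / r ^ 4"
    and p_bd: "\<And>r. r \<ge> R \<Longrightarrow> \<bar>p r - 2 * \<alpha> / r ^ 3\<bar> \<le> 2 * D / r ^ 5"
    using connects_asymptotics[OF con n] by metis
  have sol: "solution_pair F p" using con by (simp add: connects_def)
  have u_bd: "\<bar>real n * pi - F r - \<alpha> / r ^ 2\<bar> \<le> D / r ^ 4" if "r \<ge> R" for r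
    using u_le[OF that] u_ge[OF that] by (auto simp: abs_le_iff)
  have top: "bigo_deriv 4 at_top (\<lambda>r. (F r - real n * pi) - (- \<alpha>) * r powi (- 2))"
  proof (rule solution_pair_expansion[OF solution_pair_shift[OF sol]])
    show "\<forall>\<^sub>F r in at_top. \<bar>r\<bar> \<ge> (1::real)"
      using eventually_ge_at_top[of "1::real"] by eventually_elim auto
    show "(\<lambda>r. (F r - real n * pi) - (- \<alpha>) * r powi (- 2)) \<in> O(\<lambda>r. \<bar>r\<bar> powi (- 4))"
    proof (intro bigoI[of _ D] eventually_mono[OF eventually_ge_at_top[of R]])
      fix r assume "r \<ge> R"
      then show "norm ((F r - real n * pi) - (- \<alpha>) * r powi (- 2)) \<le> D * norm (\<bar>r\<bar> powi (- 4))"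
        using u_bd[of r] R by (simp add: power_int_minus field_simps abs_minus_commute)
    qed
    show "(\<lambda>r. p r + 2 * (- \<alpha>) * r powi (- 3)) \<in> O(\<lambda>r. \<bar>r\<bar> powi (- 5))"
    proof (intro bigoI[of _ "2 * D"] eventually_mono[OF eventually_ge_at_top[of R]])
      fix r assume "r \<ge> R"
      then show "norm (p r + 2 * (- \<alpha>) * r powi (- 3)) \<le> 2 * D * norm (\<bar>r\<bar> powi (- 5))"
        using p_bd[of r] R by (simp add: power_int_minus divide_inverse)
    qed
  qed
  have bot: "bigo_deriv 4 at_bot (\<lambda>r. F r - \<alpha> * r powi (- 2))"
  proof (rule solution_pair_expansion[OF sol])
    show "\<forall>\<^sub>F r in at_bot. \<bar>r\<bar> \<ge> (1::real)"
      using eventually_le_at_bot[of "-1::real"] by eventually_elim auto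
    show "(\<lambda>r. F r - \<alpha> * r powi (- 2)) \<in> O[at_bot](\<lambda>r. \<bar>r\<bar> powi (- 4))"
    proof (intro bigoI[of _ D] eventually_mono[OF eventually_le_at_bot[of "- R"]])
      fix r assume "r \<le> - R"
      then show "norm (F r - \<alpha> * r powi (- 2)) \<le> D * norm (\<bar>r\<bar> powi (- 4))"
        using u_bd[of "- r"] R sym[of r] by (simp add: power_int_minus divide_inverse algebra_simps)
    qed
    show "(\<lambda>r. p r + 2 * \<alpha> * r powi (- 3)) \<in> O[at_bot](\<lambda>r. \<bar>r\<bar> powi (- 5))"
    proof (intro bigoI[of _ "2 * D"] eventually_mono[OF eventually_le_at_bot[of "- R"]])
      fix r assume "r \<le> - R"
      then show "norm (p r + 2 * \<alpha> * r powi (- 3)) \<le> 2 * D * norm (\<bar>r\<bar> powi (- 5))"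
        using p_bd[of "- r"] R sym_p[of r] by (simp add: power_int_minus divide_inverse)
    qed
  qed
  show ?thesis
    using that[OF \<alpha> _ bot] top by (simp add: algebra_simps)
qed

theorem proposition2p1:
  fixes n :: nat
  shows "(\<exists>!F. smooth_solution n F) \<and>
    (\<forall>Q. smooth_solution n Q \<longrightarrow>
      (n = 0 \<longrightarrow> Q = (\<lambda>r. 0)) \<and>
      (n \<ge> 1 \<longrightarrow>
        strict_mono Q \<and>
        (\<forall>r. Q r + Q (- r) = real n * pi) \<and>
        (\<exists>\<alpha>>0.
          bigo_deriv 4 at_top (\<lambda>r. Q r - (real n * pi - \<alpha> * r powi (-2))) \<and>
          bigo_deriv 4 at_bot (\<lambda>r. Q r - \<alpha> * r powi (-2)))))"
proof (cases "n = 0")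
  case True
  have "connects 0 (\<lambda>_. 0) (\<lambda>_. 0)"
    using solution_pair_const[of 0] by (simp add: connects_def)
  then have "smooth_solution n (\<lambda>_. 0)"
    using connects_imp_smooth_solution True by blast
  moreover have "Q = (\<lambda>_. 0)" if "smooth_solution n Q" for Q
    using connects_trichotomy[OF smooth_solution_imp_connects[OF that]] True by auto
  ultimately show ?thesis using True by auto
next
  case False
  then have n: "n \<ge> 1" by simp
  have unique: "F = G" if "smooth_solution n F" "smooth_solution n G" for F G
    using connects_unique[OF _ _ n] that[THEN smooth_solution_imp_connects] by blast
  moreover obtain F p where "connects n F p"
    using solution_exists[OF n] unfolding connects_def by metis
  ultimately have "\<exists>!F. smooth_solution n F"
    using connects_imp_smooth_solution by blast
  moreover have "strict_mono Q \<and> (\<forall>r. Q r + Q (- r) = real n * pi) \<and>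
        (\<exists>\<alpha>>0.
          bigo_deriv 4 at_top (\<lambda>r. Q r - (real n * pi - \<alpha> * r powi (-2))) \<and>
          bigo_deriv 4 at_bot (\<lambda>r. Q r - \<alpha> * r powi (-2)))" if Q: "smooth_solution n Q" for Q
  proof -
    note con = smooth_solution_imp_connects[OF Q]
    have Q_eq: "(\<lambda>r. real n * pi - Q (- r)) = Q"
      by (rule unique[OF connects_imp_smooth_solution[OF connects_reflect[OF con]] Q])
    then have sym: "Q r + Q (- r) = real n * pi" for r
      by (metis add.commute diff_add_cancel)
    have "(Q has_real_derivative deriv Q (- r)) (at r)" for r
      using connects_reflect[OF con] solution_pairD(1) unfolding connects_def Q_eq by blast
    then have "deriv Q (- r) = deriv Q r" for r
      by (metis DERIV_imp_deriv)
    from connects_expansion[OF con n sym this] show ?thesis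
      using connects_pos(2)[OF con n] sym by metis
  qed
  ultimately show ?thesis using False by blast
qed

end
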